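(* Let $x=P(x)$ be a max/minPPS in simple normal form with least fixed point $q^*$ satisfying $0<q^*<1$ (coordinatewise), and let $j$ be a positive integer. Run the rounded-down Generalized Newton's Method with rounding parameter $h=j+2+4|P|$: $x^{(0)}=0$ and, for $k\ge0$, $x^{(k+1)}_i$ is the largest non-negative integer multiple of $2^{-h}$ that is $\le\max\{0,I(x^{(k)})_i\}$, for each $i$. Then all iterates are defined, $0\le x^{(k)}\le q^*$ for every $k\ge 0$, and $\|q^*-x^{(j+2+4|P|)}\|_\infty\le 2^{-j}$.
   Context: A probabilistic polynomial in $x=(x_1,\dots,x_n)$ is $\sum_r p_r x^{\alpha_r}$ with rational $p_r\ge0$, $\sum_rp_r\le1$. A maxPPS (minPPS) is a system $x_i=P_i(x)$, $i=1,\dots,n$, with each $P_i$ the maximum (minimum) of finitely many probabilistic polynomials; a max/minPPS is either. It is in simple normal form (SNF) if each $P_i$ has one of the forms: (L) $a_{i,0}+\sum_{j=1}^n a_{i,j}x_j$ with $a_{i,j}\ge0$ and $\sum_{j=0}^n a_{i,j}\le1$; (Q) $x_jx_k$ for some $j,k$; (M) $\max\{x_j,x_k\}$ (for a minPPS: $\min\{x_j,x_k\}$). $|P|$ is the total bit-encoding length of the system (sparse representation, binary numbers). The least fixed point (LFP) $q^*\in[0,1]^n$ is the coordinatewise least solution of $x=P(x)$ in $[0,1]^n$. For $y\in\mathbb R^n$ the linearization $P^y$ is defined by $P^y_i(x)=P_i(x)$ if $P_i$ has form L or M, and $P^y_i(x)=y_jx_k+x_jy_k-y_jy_k$ if $P_i(x)=x_jx_k$.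 For $0\le y\le q^*$, $I(y)$ is the unique optimal solution $a\in\mathbb R^n$ of the program: minimize $\sum_i a_i$ subject to $P^y(a)\le a$ (if $x=P(x)$ is a maxPPS), respectively maximize $\sum_i a_i$ subject to $P^y(a)\ge a$ (if it is a minPPS). Vector inequalities are coordinatewise. *)

theory Defs
  imports "HOL-Analysis.Analysis" "HOL-Library.Log_Nat"
begin

text \<open>
  The variables \<open>x\<^sub>1, \<dots>, x\<^sub>n\<close> are indexed by a finite type \<open>'n\<close>, so \<open>n = CARD('n)\<close> and vectors
  have type \<open>real ^ 'n\<close>, on which \<open>\<le>\<close> is the coordinatewise order.  (The order \<open><\<close> on this type
  is not coordinatewise strict inequality, which is therefore written out.)
\<close>

datatype pps_kind = MaxPPS | MinPPS

text \<open>
  A right-hand side \<open>P\<^sub>i\<close> in simple normal form: \<open>FormL a0 a\<close> is \<open>a0 + (\<Sum>j. a j * x\<^sub>j)\<close>,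
  \<open>FormQ j k\<close> is \<open>x\<^sub>j * x\<^sub>k\<close>, and \<open>FormM j k\<close> is \<open>max x\<^sub>j x\<^sub>k\<close> or \<open>min x\<^sub>j x\<^sub>k\<close>, depending on the kind
  of the whole system.
\<close>

datatype 'n snf_rhs =
    FormL rat "'n \<Rightarrow> rat"
  | FormQ 'n 'n
  | FormM 'n 'n

type_synonym 'n snf_system = "'n \<Rightarrow> 'n snf_rhs"

fun snf_rhs_wf :: "('n::finite) snf_rhs \<Rightarrow> bool" where
  "snf_rhs_wf (FormL a0 a) \<longleftrightarrow> 0 \<le> a0 \<and> (\<forall>j. 0 \<le> a j) \<and> a0 + (\<Sum>j\<in>UNIV. a j) \<le> 1"
| "snf_rhs_wf (FormQ j k) \<longleftrightarrow> True"
| "snf_rhs_wf (FormM j k) \<longleftrightarrow> True"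

definition snf_pps :: "('n::finite) snf_system \<Rightarrow> bool" where
  "snf_pps P \<longleftrightarrow> (\<forall>i. snf_rhs_wf (P i))"

fun kind_opt :: "pps_kind \<Rightarrow> real \<Rightarrow> real \<Rightarrow> real" where
  "kind_opt MaxPPS = max"
| "kind_opt MinPPS = min"

fun eval_rhs :: "pps_kind \<Rightarrow> ('n::finite) snf_rhs \<Rightarrow> real ^ 'n \<Rightarrow> real" where
  "eval_rhs \<kappa> (FormL a0 a) x = of_rat a0 + (\<Sum>j\<in>UNIV. of_rat (a j) * x $ j)"
| "eval_rhs \<kappa> (FormQ j k) x = x $ j * x $ k"
| "eval_rhs \<kappa> (FormM j k) x = kind_opt \<kappa> (x $ j) (x $ k)"

definition eval_pps :: "pps_kind \<Rightarrow> ('n::finite) snf_system \<Rightarrow> real ^ 'n \<Rightarrow> real ^ 'n" where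
  "eval_pps \<kappa> P x = (\<chi> i. eval_rhs \<kappa> (P i) x)"

definition is_lfp :: "pps_kind \<Rightarrow> ('n::finite) snf_system \<Rightarrow> real ^ 'n \<Rightarrow> bool" where
  "is_lfp \<kappa> P q \<longleftrightarrow>
     0 \<le> q \<and> q \<le> 1 \<and> eval_pps \<kappa> P q = q \<and>
     (\<forall>x. 0 \<le> x \<and> x \<le> 1 \<and> eval_pps \<kappa> P x = x \<longrightarrow> q \<le> x)"

text \<open>
  Encoding length.  A positive rational is written in lowest terms, numerator and denominator in
  binary.  Only nonzero coefficients are stored, each together with the name of its variable (the
  constant \<open>a0\<close> has none); variable names are binary strings of the length of \<open>n\<close> in binary.
  No bits are charged for separators or for marking the form of an equation.
\<close>

definition rat_size :: "rat \<Rightarrow> nat" where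
  "rat_size r = (let (p, d) = quotient_of r in nat (bitlen p) + nat (bitlen d))"

definition var_size :: "'n::finite itself \<Rightarrow> nat" where
  "var_size _ = nat (bitlen (int CARD('n)))"

fun rhs_size :: "('n::finite) snf_rhs \<Rightarrow> nat" where
  "rhs_size (FormL a0 a) =
     (if a0 = 0 then 0 else rat_size a0) +
     (\<Sum>j | a j \<noteq> 0. rat_size (a j) + var_size TYPE('n))"
| "rhs_size (FormQ j k) = 2 * var_size TYPE('n)"
| "rhs_size (FormM j k) = 2 * var_size TYPE('n)"

definition pps_size :: "('n::finite) snf_system \<Rightarrow> nat" where
  "pps_size P = (\<Sum>i\<in>UNIV. rhs_size (P i))"

fun lin_rhs :: "pps_kind \<Rightarrow> ('n::finite) snf_rhs \<Rightarrow> real ^ 'n \<Rightarrow> real ^ 'n \<Rightarrow> real" where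
  "lin_rhs \<kappa> (FormL a0 a) y x = eval_rhs \<kappa> (FormL a0 a) x"
| "lin_rhs \<kappa> (FormQ j k) y x = y $ j * x $ k + x $ j * y $ k - y $ j * y $ k"
| "lin_rhs \<kappa> (FormM j k) y x = eval_rhs \<kappa> (FormM j k) x"

definition lin_pps :: "pps_kind \<Rightarrow> ('n::finite) snf_system \<Rightarrow> real ^ 'n \<Rightarrow> real ^ 'n \<Rightarrow> real ^ 'n" where
  "lin_pps \<kappa> P y x = (\<chi> i. lin_rhs \<kappa> (P i) y x)"

fun gnm_feasible :: "pps_kind \<Rightarrow> ('n::finite) snf_system \<Rightarrow> real ^ 'n \<Rightarrow> real ^ 'n \<Rightarrow> bool" where
  "gnm_feasible MaxPPS P y a \<longleftrightarrow> lin_pps MaxPPS P y a \<le> a"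
| "gnm_feasible MinPPS P y a \<longleftrightarrow> lin_pps MinPPS P y a \<ge> a"

fun gnm_optimal :: "pps_kind \<Rightarrow> ('n::finite) snf_system \<Rightarrow> real ^ 'n \<Rightarrow> real ^ 'n \<Rightarrow> bool" where
  "gnm_optimal MaxPPS P y a \<longleftrightarrow> gnm_feasible MaxPPS P y a \<and>
     (\<forall>b. gnm_feasible MaxPPS P y b \<longrightarrow> (\<Sum>i\<in>UNIV. a $ i) \<le> (\<Sum>i\<in>UNIV. b $ i))"
| "gnm_optimal MinPPS P y a \<longleftrightarrow> gnm_feasible MinPPS P y a \<and>
     (\<forall>b. gnm_feasible MinPPS P y b \<longrightarrow> (\<Sum>i\<in>UNIV. b $ i) \<le> (\<Sum>i\<in>UNIV. a $ i))"

text \<open>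
  The operator \<open>I(y)\<close>.  It is meaningful only where the optimal solution exists and is unique.
\<close>

definition gnm_step :: "pps_kind \<Rightarrow> ('n::finite) snf_system \<Rightarrow> real ^ 'n \<Rightarrow> real ^ 'n" where
  "gnm_step \<kappa> P y = (THE a. gnm_optimal \<kappa> P y a)"

definition grid_floor :: "nat \<Rightarrow> real \<Rightarrow> real" where
  "grid_floor h v = real (GREATEST m::nat. real m / 2 ^ h \<le> max 0 v) / 2 ^ h"

primrec rgnm :: "pps_kind \<Rightarrow> ('n::finite) snf_system \<Rightarrow> nat \<Rightarrow> nat \<Rightarrow> real ^ 'n" where
  "rgnm \<kappa> P h 0 = 0"
| "rgnm \<kappa> P h (Suc k) = (\<chi> i. grid_floor h (gnm_step \<kappa> P (rgnm \<kappa> P h k) $ i))"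

end

theory Submission
  imports Defs
begin

text \<open>
  Put \<open>v = 1 - q\<close>.  The point \<open>q - s v\<close> is a fixed point of every L and M equation up to the
  probability lost in the equation, and satisfies \<open>a \<le> P\<^sup>y(a)\<close> as soon as \<open>q - y \<le> 2 s v\<close>.  For a
  minPPS the feasible region is closed under coordinatewise maxima, so \<open>I(y)\<close> is its greatest
  element and lies above \<open>q - s v\<close>; for a maxPPS \<open>I(y)\<close> is the least feasible point, and the
  same bound follows by comparison.  Hence one step halves the error measured in units of \<open>v\<close>.
  The comparisons of feasible points \<open>b\<close> with \<open>q\<close> (minPPS) or \<open>q - s v\<close> (maxPPS) move along the
  ray \<open>q - s v\<close> to the first point that bounds \<open>b\<close>.  The coordinates in which it touches \<open>b\<close>
  form a linear, lossless, closed subsystem, and such a subsystem contradicts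
  the minimality of \<open>q\<close>.

  Moreover \<open>v \<ge> 2 ^ (-4|P|)\<close>: if \<open>1 - \<epsilon> w\<close> is a pre-fixed point in the unit cube, then
  \<open>v \<ge> \<epsilon> w\<close>.  A suitable \<open>w \<ge> 1\<close> is found as a vertex of an integral polyhedron that is nonempty
  because a multiple of \<open>v\<close> lies in it, and Cramer's rule bounds the coordinates of that vertex.
\<close>

section \<open>Vertices of integral polyhedra\<close>

text \<open>Expanding the product of row sums gives one term for every map from rows to columns; the
  Leibniz formula runs over the permutations only.\<close>

lemma abs_det_le_prod_row_sums:
  fixes N :: "real ^ 'm ^ 'm"
  shows "\<bar>det N\<bar> \<le> (\<Prod>i\<in>UNIV. \<Sum>c\<in>UNIV. \<bar>N $ i $ c\<bar>)"
proof -
  have "\<bar>det N\<bar> \<le> (\<Sum>p | p permutes (UNIV :: 'm set). \<bar>of_int (sign p) * (\<Prod>i\<in>UNIV. N $ i $ p i)\<bar>)"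
    unfolding det_def by (rule sum_abs)
  also have "\<dots> = (\<Sum>p | p permutes (UNIV :: 'm set). \<Prod>i\<in>UNIV. \<bar>N $ i $ p i\<bar>)"
    by (intro sum.cong refl) (auto simp: abs_mult sign_def abs_prod)
  also have "\<dots> \<le> (\<Sum>p\<in>UNIV. \<Prod>i\<in>UNIV. \<bar>N $ i $ p i\<bar>)"
    by (intro sum_mono2) (auto intro: prod_nonneg)
  also have "\<dots> = (\<Prod>i\<in>UNIV. \<Sum>c\<in>UNIV. \<bar>N $ i $ c\<bar>)"
    by (subst prod_sum_PiE) (auto simp: PiE_UNIV_domain)
  finally show ?thesis .
qed

lemma abs_det_ge_one:
  fixes M :: "real ^ 'm ^ 'm"
  assumes "\<And>i c. M $ i $ c \<in> \<int>" and "det M \<noteq> 0"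
  shows "1 \<le> \<bar>det M\<bar>"
proof -
  have "det M \<in> \<int>"
    unfolding det_def by (intro Ints_sum Ints_mult Ints_prod) (auto simp: assms)
  then show ?thesis using assms(2) by (rule Ints_nonzero_abs_ge1)
qed

text \<open>A feasible point with the largest number of tight constraints is a vertex: otherwise it
  could move orthogonally to all tight rows until one more constraint becomes tight.\<close>

lemma polyhedron_vertex_exists:
  fixes A :: "'l::finite \<Rightarrow> real ^ 'm" and b :: "'l \<Rightarrow> real"
  assumes feas: "\<And>l. b l \<le> A l \<bullet> x0"
    and spanA: "span (range A) = UNIV"
  obtains x where "\<And>l. b l \<le> A l \<bullet> x" and "span (A ` {l. A l \<bullet> x = b l}) = UNIV"
proof -
  define F where "F = {x. \<forall>l. b l \<le> A l \<bullet> x}"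
  define tight where "tight x = {l. A l \<bullet> x = b l}" for x
  have "x0 \<in> F" using feas by (auto simp: F_def)
  moreover have "\<forall>y. y \<in> F \<longrightarrow> card (tight y) < Suc CARD('l)"
    by (simp add: card_mono less_Suc_eq_le)
  ultimately obtain x where xF: "x \<in> F" and max: "\<And>y. y \<in> F \<Longrightarrow> card (tight y) \<le> card (tight x)"
    using ex_has_greatest_nat[of "\<lambda>x. x \<in> F" x0 "\<lambda>x. card (tight x)" "Suc CARD('l)"] by metis
  have "span (A ` tight x) = UNIV"
  proof (rule ccontr)
    assume "span (A ` tight x) \<noteq> UNIV"
    then obtain d where d: "d \<noteq> 0" "\<And>y. y \<in> span (A ` tight x) \<Longrightarrow> orthogonal d y"
      using orthogonal_to_subspace_exists_gen[of "A ` tight x" UNIV] by auto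
    have dt: "A l \<bullet> d = 0" if "l \<in> tight x" for l
      using d(2)[OF span_base[of "A l"]] that by (auto simp: orthogonal_def inner_commute)
    have "\<exists>l. A l \<bullet> d \<noteq> 0"
    proof (rule ccontr)
      assume "\<not> ?thesis"
      then have "orthogonal d y" if "y \<in> range A" for y
        using that by (auto simp: orthogonal_def inner_commute)
      then have "orthogonal d d"
        using orthogonal_to_span[of d "range A" d] spanA by auto
      then show False using d(1) by (simp add: orthogonal_def)
    qed
    \<comment> \<open>The sign of \<open>d\<close> is chosen so that some constraint decreases along
      \<open>e\<close> and is eventually hit.\<close>
    then obtain e where e: "\<And>l. l \<in> tight x \<Longrightarrow> A l \<bullet> e = 0" "\<exists>l. A l \<bullet> e < 0"
    proof (cases "\<exists>l. A l \<bullet> d < 0")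
      case False
      then show ?thesis using \<open>\<exists>l. A l \<bullet> d \<noteq> 0\<close> dt that[of "- d"]
        by (auto simp: neq_iff)
    qed (use dt in \<open>auto intro: that[of d]\<close>)
    \<comment> \<open>Ratio test: \<open>s\<close> is the largest step along \<open>e\<close> that
      violates no constraint, and \<open>l0\<close> is a constraint that becomes tight
      there.\<close>
    define N where "N = {l. A l \<bullet> e < 0}"
    define r where "r l = (A l \<bullet> x - b l) / - (A l \<bullet> e)" for l
    define s where "s = Min (r ` N)"
    have N: "finite (r ` N)" "r ` N \<noteq> {}" using e(2) by (auto simp: N_def)
    then obtain l0 where l0: "l0 \<in> N" "r l0 = s" unfolding s_def by (metis Min_in imageE)
    have s0: "0 \<le> s" unfolding s_def
      using N xF by (auto simp: r_def N_def F_def intro!: divide_nonneg_neg)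
    have sle: "s \<le> r l" if "l \<in> N" for l using that N by (auto simp: s_def)
    have "b l \<le> A l \<bullet> (x + s *\<^sub>R e)" for l
    proof (cases "l \<in> N")
      case True
      then have "s * - (A l \<bullet> e) \<le> A l \<bullet> x - b l"
        using sle[OF True] True unfolding r_def N_def by (subst (asm) pos_le_divide_eq) auto
      then show ?thesis by (simp add: inner_add_right)
    next
      case False
      then have "0 \<le> s * (A l \<bullet> e)" using s0 by (simp add: N_def)
      then show ?thesis using xF by (auto simp: inner_add_right F_def intro: add_increasing2)
    qed
    then have xF': "x + s *\<^sub>R e \<in> F" by (simp add: F_def)
    have "l0 \<notin> tight x" using e(1) l0(1) by (force simp: N_def)
    moreover have "insert l0 (tight x) \<subseteq> tight (x + s *\<^sub>R e)"
    proof -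
      have "A l0 \<bullet> x + s * (A l0 \<bullet> e) = b l0"
        using l0 by (auto simp: r_def N_def field_simps)
      then show ?thesis using e(1) by (auto simp: tight_def inner_add_right)
    qed
    ultimately have "card (tight x) < card (tight (x + s *\<^sub>R e))"
      by (metis card_mono card_insert_disjoint finite_code Suc_le_eq)
    then show False using max[OF xF'] by simp
  qed
  then show ?thesis using xF by (intro that[of x]) (simp_all add: F_def tight_def)
qed

text \<open>A vertex solves a square system made of independent tight rows. In Cramer's rule the
  denominator is a nonzero integer, and the numerator is at most a product of row sums. The factors
  \<open>max 1\<close> let the bound range over all constraints, whichever rows were chosen.\<close>

lemma integral_polyhedron_bounded_point:
  fixes A :: "'l::finite \<Rightarrow> real ^ 'm" and b :: "'l \<Rightarrow> real"
  assumes int: "\<And>l c. A l $ c \<in> \<int>"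
    and feas: "\<And>l. b l \<le> A l \<bullet> x0"
    and spanA: "span (range A) = UNIV"
  obtains x where "\<And>l. b l \<le> A l \<bullet> x"
    and "\<And>c. \<bar>x $ c\<bar> \<le> (\<Prod>l\<in>UNIV. max 1 (\<bar>b l\<bar> + (\<Sum>c\<in>UNIV. \<bar>A l $ c\<bar>)))"
proof -
  obtain x where x: "\<And>l. b l \<le> A l \<bullet> x" and sp: "span (A ` {l. A l \<bullet> x = b l}) = UNIV"
    using polyhedron_vertex_exists[OF feas spanA] by blast
  define T where "T = {l. A l \<bullet> x = b l}"
  define wt where "wt l = \<bar>b l\<bar> + (\<Sum>c\<in>UNIV. \<bar>A l $ c\<bar>)" for l
  obtain B where B: "B \<subseteq> A ` T" "independent B" "A ` T \<subseteq> span B" "card B = dim (A ` T)"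
    using basis_exists by blast
  have spB: "span B = UNIV"
    using B sp by (metis T_def span_mono span_span top.extremum_uniqueI)
  have cB: "card B = CARD('m)"
    using B(4) sp by (metis T_def dim_UNIV dim_span DIM_cart DIM_real mult.right_neutral)
  have "finite B" using B(2) by (rule independent_imp_finite)
  then obtain f where f: "bij_betw f (UNIV :: 'm set) B"
    using cB finite_same_card_bij[of "UNIV :: 'm set" B] by auto
  have "\<exists>l. l \<in> T \<and> A l = f i" for i
  proof -
    have "f i \<in> A ` T" using bij_betwE[OF f] B(1) by blast
    then show ?thesis by (auto simp: image_iff)
  qed
  then obtain g where g: "\<And>i. g i \<in> T" "\<And>i. A (g i) = f i" by metis
  have injg: "inj g"
    using f g(2) unfolding bij_betw_def inj_on_def by metis
  define M :: "real ^ 'm ^ 'm" where "M = (\<chi> i. A (g i))"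
  define \<beta> :: "real ^ 'm" where "\<beta> = (\<chi> i. b (g i))"
  have "z = 0" if "M *v z = 0" for z
  proof -
    have "A (g i) \<bullet> z = 0" for i
      using that by (metis M_def matrix_vector_mul_component vec_lambda_beta zero_index)
    then have "orthogonal z y" if "y \<in> B" for y
      using that f g(2) by (metis bij_betw_imp_surj_on imageE orthogonal_def inner_commute)
    then have "orthogonal z z"
      using orthogonal_to_span[of z B z] spB by auto
    then show ?thesis by (simp add: orthogonal_def)
  qed
  then have "invertible M"
    by (metis invertible_left_inverse matrix_left_invertible_ker)
  then have det0: "det M \<noteq> 0" by (simp add: invertible_det_nz)
  have "M *v x = \<beta>"
    using g(1) by (auto simp: M_def \<beta>_def T_def vec_eq_iff matrix_vector_mul_component)
  then have cr: "x = (\<chi> k. det (\<chi> i j. if j = k then \<beta> $ i else M $ i $ j) / det M)"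
    using cramer[OF det0] by blast
  have det1: "1 \<le> \<bar>det M\<bar>"
    by (intro abs_det_ge_one det0) (auto simp: M_def int)
  have "\<bar>x $ k\<bar> \<le> (\<Prod>l\<in>UNIV. max 1 (wt l))" for k
  proof -
    let ?N = "(\<chi> i j. if j = k then \<beta> $ i else M $ i $ j) :: real ^ 'm ^ 'm"
    have "x $ k = det ?N / det M" by (subst cr) simp
    then have "\<bar>x $ k\<bar> = \<bar>det ?N\<bar> / \<bar>det M\<bar>" by simp
    also have "\<dots> \<le> \<bar>det ?N\<bar>"
      using det1 by (simp add: divide_le_eq mult_le_cancel_left1)
    also have "\<dots> \<le> (\<Prod>i\<in>UNIV. \<Sum>c\<in>UNIV. \<bar>?N $ i $ c\<bar>)" by (rule abs_det_le_prod_row_sums)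
    also have "\<dots> \<le> (\<Prod>i\<in>UNIV. max 1 (wt (g i)))"
    proof (intro prod_mono conjI sum_nonneg)
      fix i
      \<comment> \<open>Replacing column \<open>k\<close> by \<open>\<beta>\<close> adds at most
        \<open>\<bar>\<beta> $ i\<bar>\<close> to the row sum, hence the summand
        \<open>\<bar>b l\<bar>\<close> in \<open>wt\<close>.\<close>
      have "(\<Sum>c\<in>UNIV. \<bar>?N $ i $ c\<bar>)
          \<le> (\<Sum>c\<in>UNIV. (if c = k then \<bar>\<beta> $ i\<bar> else 0) + \<bar>M $ i $ c\<bar>)"
        by (intro sum_mono) auto
      also have "\<dots> = wt (g i)" by (simp add: sum.distrib wt_def \<beta>_def M_def)
      finally show "(\<Sum>c\<in>UNIV. \<bar>?N $ i $ c\<bar>) \<le> max 1 (wt (g i))" by simp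
    qed auto
    also have "\<dots> = (\<Prod>l\<in>range g. max 1 (wt l))" by (simp add: prod.reindex injg)
    also have "\<dots> \<le> (\<Prod>l\<in>UNIV. max 1 (wt l))" by (intro prod_mono2) auto
    finally show ?thesis .
  qed
  then show ?thesis using x by (intro that[of x]) (simp_all add: wt_def)
qed

section \<open>Newton steps\<close>

lemma snf_ppsD:
  assumes "snf_pps P" "P i = FormL a0 a"
  shows "0 \<le> real_of_rat a0" "0 \<le> real_of_rat (a j)"
    "real_of_rat a0 + (\<Sum>j\<in>UNIV. real_of_rat (a j)) \<le> 1"
proof -
  have "snf_rhs_wf (FormL a0 a)" using assms by (metis snf_pps_def)
  then have *: "0 \<le> a0" "0 \<le> a j" "a0 + (\<Sum>j\<in>UNIV. a j) \<le> 1" by auto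
  then show "0 \<le> real_of_rat a0" "0 \<le> real_of_rat (a j)" by simp_all
  have "real_of_rat (a0 + (\<Sum>j\<in>UNIV. a j)) \<le> 1" using *(3) by simp
  then show "real_of_rat a0 + (\<Sum>j\<in>UNIV. real_of_rat (a j)) \<le> 1"
    by (simp add: of_rat_add of_rat_sum)
qed

lemma kind_opt_mono: "a \<le> a' \<Longrightarrow> b \<le> b' \<Longrightarrow> kind_opt \<kappa> a b \<le> kind_opt \<kappa> a' b'"
  by (cases \<kappa>) auto

lemma eval_rhs_mono:
  assumes "snf_pps P" "0 \<le> x" "x \<le> y"
  shows "eval_rhs \<kappa> (P i) x \<le> eval_rhs \<kappa> (P i) y"
  using assms snf_ppsD[OF assms(1), of i] order_trans[OF assms(2,3)]
  by (cases "P i") (auto simp: less_eq_vec_def intro!: sum_mono mult_left_mono mult_mono kind_opt_mono)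

text \<open>The coefficients of a linearized product are coordinates of \<open>y\<close>, so
  monotonicity also covers arguments with negative coordinates, such as far points of the
  ray.\<close>

lemma lin_rhs_mono:
  assumes "snf_pps P" "0 \<le> y" "a \<le> b"
  shows "lin_rhs \<kappa> (P i) y a \<le> lin_rhs \<kappa> (P i) y b"
  using assms snf_ppsD[OF assms(1), of i]
  by (cases "P i") (auto simp: less_eq_vec_def
      intro!: sum_mono add_mono mult_left_mono mult_right_mono kind_opt_mono)

lemma eval_rhs_nonneg: "snf_pps P \<Longrightarrow> 0 \<le> x \<Longrightarrow> 0 \<le> eval_rhs \<kappa> (P i) x"
  using snf_ppsD[of P i]
  by (cases "P i"; cases \<kappa>) (auto simp: less_eq_vec_def le_max_iff_disj intro!: sum_nonneg add_nonneg_nonneg)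

text \<open>Knaster-Tarski: \<open>is_lfp\<close> compares \<open>q\<close> with fixed points only,
  and the infimum of all pre-fixed points in the unit cube is a fixed point.\<close>

lemma lfp_le_prefixpoint:
  fixes P :: "('n::finite) snf_system"
  assumes wf: "snf_pps P" and lfp: "is_lfp \<kappa> P q"
    and x: "0 \<le> x" "x \<le> 1" "eval_pps \<kappa> P x \<le> x"
  shows "q \<le> x"
proof -
  define S where "S = {x. 0 \<le> x \<and> x \<le> 1 \<and> eval_pps \<kappa> P x \<le> x}"
  define z :: "real ^ 'n" where "z = (\<chi> i. INF x\<in>S. x $ i)"
  have xS: "x \<in> S" using x by (simp add: S_def)
  have bdd: "bdd_below ((\<lambda>x. x $ i) ` S)" for i
    by (rule bdd_belowI[of _ 0]) (auto simp: S_def less_eq_vec_def)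
  have z_le: "z \<le> w" if "w \<in> S" for w
    using that bdd by (auto simp: z_def less_eq_vec_def intro: cINF_lower)
  have le_z: "w \<le> z" if "\<And>u. u \<in> S \<Longrightarrow> w \<le> u" for w
    using that xS by (auto simp: z_def less_eq_vec_def intro!: cINF_greatest)
  have z0: "0 \<le> z" by (rule le_z) (simp add: S_def)
  have z1: "z \<le> 1" using z_le[OF xS] x(2) by simp
  have mono: "eval_pps \<kappa> P a \<le> eval_pps \<kappa> P b" if "0 \<le> a" "a \<le> b" for a b
    using eval_rhs_mono[OF wf that] by (simp add: eval_pps_def less_eq_vec_def)
  have Pz: "eval_pps \<kappa> P z \<le> z"
  proof (rule le_z)
    fix u assume u: "u \<in> S"
    then show "eval_pps \<kappa> P z \<le> u"
      using mono[OF z0 z_le[OF u]] by (auto simp: S_def intro: order_trans)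
  qed
  have P0: "0 \<le> eval_pps \<kappa> P z"
    using eval_rhs_nonneg[OF wf z0] by (simp add: eval_pps_def less_eq_vec_def)
  have "eval_pps \<kappa> P z \<in> S"
    using P0 Pz z1 mono[OF P0 Pz] by (auto simp: S_def intro: order_trans)
  then have "eval_pps \<kappa> P z = z" using Pz z_le by (intro antisym) auto
  then have "q \<le> z" using lfp z0 z1 by (simp add: is_lfp_def)
  then show ?thesis using z_le[OF xS] by simp
qed

section \<open>Rounding and elementary inequalities\<close>

lemma grid_floor_bounds:
  shows grid_floor_nonneg: "0 \<le> grid_floor h v"
    and grid_floor_le: "grid_floor h v \<le> max 0 v"
    and grid_floor_ge: "v - 1 / 2 ^ h \<le> grid_floor h v"
proof -
  define w where "w = 2 ^ h * max 0 v"
  have w0: "0 \<le> w" by (simp add: w_def)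
  have *: "real m / 2 ^ h \<le> max 0 v \<longleftrightarrow> m \<le> nat \<lfloor>w\<rfloor>" for m :: nat
    using w0 by (simp add: w_def le_nat_iff le_floor_iff divide_le_eq mult.commute)
  have "(GREATEST m::nat. real m / 2 ^ h \<le> max 0 v) = nat \<lfloor>w\<rfloor>"
    unfolding * by (intro Greatest_equality) auto
  then have eq: "grid_floor h v = real (nat \<lfloor>w\<rfloor>) / 2 ^ h" by (simp add: grid_floor_def)
  show "0 \<le> grid_floor h v" by (simp add: eq)
  show "grid_floor h v \<le> max 0 v" unfolding eq * by simp
  have "w - 1 \<le> real (nat \<lfloor>w\<rfloor>)" using w0 by linarith
  then have "(w - 1) / 2 ^ h \<le> grid_floor h v" unfolding eq by (intro divide_right_mono) auto
  moreover have "(w - 1) / 2 ^ h = max 0 v - 1 / 2 ^ h" by (simp add: w_def diff_divide_distrib)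
  ultimately show "v - 1 / 2 ^ h \<le> grid_floor h v" by linarith
qed

text \<open>Each of \<open>s * dj * vk\<close> and \<open>s * dk * vj\<close> is at least half of
  \<open>dj * dk\<close>; the term \<open>s * vj * vk\<close> makes the inequality strict. The
  factor 2 in the hypotheses is what makes a Newton step halve the error.\<close>

lemma ray_Q_slack:
  assumes "0 < s" "0 \<le> dj" "0 \<le> dk" "0 < vj" "0 < vk" "dj \<le> 2 * s * vj" "dk \<le> 2 * s * (vk::real)"
  shows "dj * dk < s * (vj * vk + dj * vk + dk * vj)"
proof -
  have "dj * dk \<le> dj * (2 * s * vk)" "dk * dj \<le> dk * (2 * s * vj)"
    using assms by (auto intro!: mult_left_mono)
  moreover have "0 < s * (vj * vk)" using assms by simp
  ultimately show ?thesis by (simp add: algebra_simps)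
qed

lemma weighted_sum_zero_support:
  fixes w z :: "'n::finite \<Rightarrow> real"
  assumes "\<And>j. 0 \<le> w j" "\<And>j. 0 \<le> z j" "(\<Sum>j\<in>UNIV. w j * z j) \<le> 0" "w j \<noteq> 0"
  shows "z j = 0"
proof -
  have "(\<Sum>j\<in>UNIV. w j * z j) = 0"
    using assms by (intro antisym sum_nonneg) auto
  then have "w j * z j = 0" using assms by (subst (asm) sum_nonneg_eq_0_iff) auto
  then show ?thesis using assms(4) by simp
qed

text \<open>Turns optimality of the coordinate sum into uniqueness, once a least or greatest
  feasible point is known.\<close>

lemma eq_of_le_of_sum_le:
  fixes a b :: "real ^ 'n"
  assumes "a \<le> b" "(\<Sum>i\<in>UNIV. b $ i) \<le> (\<Sum>i\<in>UNIV. a $ i)"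
  shows "a = b"
proof -
  have "b $ i - a $ i = 0" for i
    using weighted_sum_zero_support[of "\<lambda>_. 1" "\<lambda>i. b $ i - a $ i" i] assms
    by (simp add: less_eq_vec_def sum_subtractf)
  then show ?thesis by (simp add: vec_eq_iff)
qed

section \<open>Systems with least fixed point strictly between 0 and 1\<close>

locale snf_lfp_interior =
  fixes \<kappa> :: pps_kind and P :: "('n::finite) snf_system" and q :: "real ^ 'n"
  assumes wf: "snf_pps P" and lfp: "is_lfp \<kappa> P q"
    and q_pos: "0 < q $ i" and q_less_one: "q $ i < 1"
begin

lemma eval_q: "eval_rhs \<kappa> (P i) q = q $ i"
proof -
  have "eval_pps \<kappa> P q $ i = q $ i" using lfp by (simp add: is_lfp_def)
  then show ?thesis by (simp add: eval_pps_def)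
qed

lemma eval_q_L: "P i = FormL a0 a \<Longrightarrow> q $ i = of_rat a0 + (\<Sum>j\<in>UNIV. of_rat (a j) * q $ j)"
  using eval_q[of i] by simp

lemma eval_q_Q: "P i = FormQ j k \<Longrightarrow> q $ i = q $ j * q $ k"
  using eval_q[of i] by simp

lemma eval_q_M: "P i = FormM j k \<Longrightarrow> q $ i = kind_opt \<kappa> (q $ j) (q $ k)"
  using eval_q[of i] by simp

text \<open>
  On the variables of \<open>T\<close> with the smallest value \<open>m\<close>, the least fixed point could be
  lowered slightly and would stay a pre-fixed point.
\<close>

lemma no_closed_lossless_set:
  assumes ne: "T \<noteq> {}"
    and L: "\<And>i a0 a. i \<in> T \<Longrightarrow> P i = FormL a0 a \<Longrightarrow>
        real_of_rat a0 + (\<Sum>j\<in>UNIV. real_of_rat (a j)) = 1 \<and> (\<forall>j. a j \<noteq> 0 \<longrightarrow> j \<in> T)"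
    and Q: "\<And>i j k. i \<in> T \<Longrightarrow> P i \<noteq> FormQ j k"
    and M_Max: "\<And>i j k l. i \<in> T \<Longrightarrow> P i = FormM j k \<Longrightarrow> \<kappa> = MaxPPS \<Longrightarrow>
        l \<in> {j, k} \<Longrightarrow> q $ l = q $ i \<Longrightarrow> l \<in> T"
    and M_Min: "\<And>i j k. i \<in> T \<Longrightarrow> P i = FormM j k \<Longrightarrow> \<kappa> = MinPPS \<Longrightarrow>
        \<exists>l\<in>{j, k}. q $ l = q $ i \<and> l \<in> T"
  shows False
proof -
  define m where "m = Min ((\<lambda>i. q $ i) ` T)"
  define U where "U = {i \<in> T. q $ i = m}"
  have m_le: "m \<le> q $ i" if "i \<in> T" for i using that by (simp add: m_def)
  have "m \<in> (\<lambda>i. q $ i) ` T" unfolding m_def using ne by (intro Min_in) auto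
  then obtain i0 where i0: "i0 \<in> U" by (auto simp: U_def)
  then have m01: "0 < m" "m < 1" using q_pos[of i0] q_less_one[of i0] by (auto simp: U_def)
  \<comment> \<open>A decrease by \<open>\<delta>\<close> keeps \<open>m - \<delta>\<close>
    nonnegative and does not pass any value of \<open>q\<close> below \<open>m\<close>.\<close>
  define \<delta> where "\<delta> = Min (insert m ((\<lambda>k. m - q $ k) ` {k. q $ k < m}))"
  have \<delta>_pos: "0 < \<delta>" unfolding \<delta>_def using m01 by (subst Min_gr_iff) auto
  have \<delta>_m: "\<delta> \<le> m" unfolding \<delta>_def by (intro Min_le) auto
  have \<delta>_gap: "q $ k \<le> m - \<delta>" if "q $ k < m" for k
  proof -
    have "\<delta> \<le> m - q $ k" unfolding \<delta>_def using that by (intro Min_le) auto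
    then show ?thesis by simp
  qed
  define x :: "real ^ 'n" where "x = (\<chi> i. if i \<in> U then m - \<delta> else q $ i)"
  have x_le: "x \<le> q" using \<delta>_pos by (auto simp: x_def less_eq_vec_def U_def)
  have x0: "0 \<le> x" using \<delta>_m q_pos by (auto simp: x_def less_eq_vec_def intro: less_imp_le)
  have xU: "x $ l = m - \<delta>" if "l \<in> T" "q $ l = m" for l using that by (simp add: x_def U_def)
  have "eval_rhs \<kappa> (P i) x \<le> x $ i" for i
  proof (cases "i \<in> U")
    case False
    then show ?thesis using eval_rhs_mono[OF wf x0 x_le, of \<kappa> i] eval_q[of i] by (simp add: x_def)
  next
    case True
    then have iT: "i \<in> T" and qi: "q $ i = m" and xi: "x $ i = m - \<delta>"
      by (auto simp: U_def x_def)
    show ?thesis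
    proof (cases "P i")
      case (FormL a0 a)
      let ?a = "\<lambda>j. real_of_rat (a j)"
      note nn = snf_ppsD(1,2)[OF wf FormL]
      have sum1: "real_of_rat a0 + (\<Sum>j\<in>UNIV. ?a j) = 1" and dep: "\<And>j. a j \<noteq> 0 \<Longrightarrow> j \<in> T"
        using L[OF iT FormL] by auto
      \<comment> \<open>Here \<open>m\<close> is a weighted average, of total weight 1, of the
        number \<open>1 > m\<close> and of values \<open>q $ j \<ge> m\<close>. Hence the constant
        is 0 and all values that occur equal \<open>m\<close>.\<close>
      have "(\<Sum>j\<in>UNIV. ?a j * (q $ j - m)) = (\<Sum>j\<in>UNIV. ?a j * q $ j) - (\<Sum>j\<in>UNIV. ?a j) * m"
        by (simp add: right_diff_distrib sum_subtractf sum_distrib_right)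
      also have "\<dots> = (m - of_rat a0) - (1 - of_rat a0) * m"
        using eval_q_L[OF FormL] sum1 qi by simp
      finally have eq: "of_rat a0 * (1 - m) + (\<Sum>j\<in>UNIV. ?a j * (q $ j - m)) = 0"
        by (simp add: algebra_simps)
      have t0: "0 \<le> ?a j * (q $ j - m)" for j
        using nn(2)[of j] m_le[of j] dep[of j] by (cases "a j = 0") auto
      have s0: "0 \<le> (\<Sum>j\<in>UNIV. ?a j * (q $ j - m))" using t0 by (intro sum_nonneg) auto
      have p0: "0 \<le> of_rat a0 * (1 - m)" using nn(1) m01 by simp
      have "of_rat a0 * (1 - m) = 0" and "(\<Sum>j\<in>UNIV. ?a j * (q $ j - m)) = 0"
        using eq s0 p0 by linarith+
      then have a0: "real_of_rat a0 = 0" and "\<forall>j. ?a j * (q $ j - m) = 0"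
        using m01 t0 by (auto simp: sum_nonneg_eq_0_iff)
      then have "?a j * x $ j = ?a j * (m - \<delta>)" for j
        using xU[of j] dep[of j] by (cases "a j = 0") auto
      then have "(\<Sum>j\<in>UNIV. ?a j * x $ j) = (\<Sum>j\<in>UNIV. ?a j) * (m - \<delta>)"
        unfolding sum_distrib_right by (intro sum.cong refl)
      then show ?thesis using FormL a0 sum1 xi by simp
    next
      case (FormQ j k)
      then show ?thesis using Q[OF iT] by blast
    next
      case (FormM j k)
      show ?thesis
      proof (cases \<kappa>)
        case MaxPPS
        \<comment> \<open>Both arguments of a maximum must be low enough: those of value
          \<open>m\<close> lie in \<open>T\<close> and are lowered, the others are below the gap
          already. For a minimum one lowered argument suffices.\<close>
        have "x $ l \<le> m - \<delta>" if l: "l \<in> {j, k}" for l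
        proof (cases "q $ l = m")
          case True
          then show ?thesis using M_Max[OF iT FormM MaxPPS l] xU[of l] qi by simp
        next
          case False
          have "q $ l \<le> m" using eval_q_M[OF FormM] MaxPPS l qi by auto
          then show ?thesis using False \<delta>_gap[of l] x_le
            by (auto simp: less_eq_vec_def intro: order_trans)
        qed
        then show ?thesis using FormM MaxPPS xi by simp
      next
        case MinPPS
        then show ?thesis using M_Min[OF iT FormM MinPPS] FormM xi qi xU by (auto simp: min_le_iff_disj)
      qed
    qed
  qed
  then have "eval_pps \<kappa> P x \<le> x" by (simp add: eval_pps_def less_eq_vec_def)
  moreover have "x \<le> 1" using x_le lfp by (auto simp: is_lfp_def intro: order_trans)
  ultimately have "q \<le> x" using lfp_le_prefixpoint[OF wf lfp x0] by blast
  then have "q $ i0 \<le> x $ i0" by (simp add: less_eq_vec_def)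
  then show False using i0 \<delta>_pos by (simp add: x_def U_def)
qed

section \<open>The line through \<open>q\<close> and the all-ones vector\<close>

definition ray :: "real \<Rightarrow> real ^ 'n" where
  "ray s = (\<chi> i. q $ i - s * (1 - q $ i))"

lemma ray_nth: "ray s $ i = q $ i - s * (1 - q $ i)"
  by (simp add: ray_def)

text \<open>The line has \<open>q\<close> at \<open>s = 0\<close> and the all-ones vector at
  \<open>s = -1\<close>. An affine equation fixes \<open>q\<close> and maps the all-ones vector to 1
  minus the lost probability, so the excess is \<open>s\<close> times that loss.\<close>

lemma lin_ray_L:
  assumes "P i = FormL a0 a"
  shows "lin_rhs \<kappa> (P i) y (ray s) =
    ray s $ i + s * (1 - (of_rat a0 + (\<Sum>j\<in>UNIV. of_rat (a j))))"
proof -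
  have "(\<Sum>j\<in>UNIV. of_rat (a j) * ray s $ j) =
      (1 + s) * (\<Sum>j\<in>UNIV. of_rat (a j) * q $ j) - s * (\<Sum>j\<in>UNIV. of_rat (a j))"
    by (simp add: ray_nth sum_distrib_left flip: sum_subtractf) (simp add: algebra_simps)
  also have "(\<Sum>j\<in>UNIV. of_rat (a j) * q $ j) = q $ i - of_rat a0"
    using eval_q_L[OF assms] by simp
  finally show ?thesis by (simp add: assms ray_nth algebra_simps)
qed

text \<open>With \<open>d = q - y\<close>, the last term is the linearization error at
  \<open>q\<close>, and the term with factor \<open>s\<close> is the first-order gain along the
  line.\<close>

lemma lin_ray_Q:
  assumes "P i = FormQ j k"
  shows "lin_rhs \<kappa> (P i) y (ray s) = ray s $ i
    + s * ((1 - q $ j) * (1 - q $ k) + (q $ j - y $ j) * (1 - q $ k) + (q $ k - y $ k) * (1 - q $ j))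
    - (q $ j - y $ j) * (q $ k - y $ k)"
  by (simp add: assms ray_nth eval_q_Q[OF assms] algebra_simps)

text \<open>For \<open>0 \<le> s\<close> the map from \<open>u\<close> to
  \<open>u - s * (1 - u)\<close> is increasing, so it commutes with max and min.\<close>

lemma lin_ray_M:
  assumes "P i = FormM j k" "0 \<le> s"
  shows "lin_rhs \<kappa> (P i) y (ray s) = ray s $ i"
proof -
  have *: "ray s $ l \<le> ray s $ l'" if "q $ l \<le> q $ l'" for l l'
    using mult_left_mono[of "q $ l" "q $ l'" "1 + s"] that assms(2)
    by (simp add: ray_nth algebra_simps)
  have "q $ i = kind_opt \<kappa> (q $ j) (q $ k)" by (rule eval_q_M[OF assms(1)])
  then show ?thesis using *[of j k] *[of k j] assms(1) linear[of "q $ j" "q $ k"]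
    by (cases \<kappa>) (auto simp: max_def min_def ray_nth)
qed

lemma ray_le_lin_ray:
  assumes y: "y \<le> q" and s: "0 < s" and ys: "\<And>i. q $ i - y $ i \<le> 2 * s * (1 - q $ i)"
  shows "ray s \<le> lin_pps \<kappa> P y (ray s)"
proof -
  have "ray s $ i \<le> lin_rhs \<kappa> (P i) y (ray s)" for i
  proof (cases "P i")
    case (FormL a0 a)
    then show ?thesis using lin_ray_L[OF FormL, of y s] snf_ppsD(3)[OF wf FormL] s by simp
  next
    case (FormQ j k)
    have "(q $ j - y $ j) * (q $ k - y $ k) < s * ((1 - q $ j) * (1 - q $ k)
        + (q $ j - y $ j) * (1 - q $ k) + (q $ k - y $ k) * (1 - q $ j))"
      using y s ys q_less_one by (intro ray_Q_slack) (auto simp: less_eq_vec_def)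
    then show ?thesis using lin_ray_Q[OF FormQ, of y s] by linarith
  next
    case (FormM j k)
    then show ?thesis using lin_ray_M[OF FormM, of s y] s by simp
  qed
  then show ?thesis by (simp add: lin_pps_def less_eq_vec_def)
qed

text \<open>If \<open>b\<close> fails the bound, the first point \<open>ray t\<close> below
  \<open>b\<close> has \<open>t > s\<close>. At a touching coordinate \<open>ray t\<close>, its
  linearization, the linearization of \<open>b\<close>, and \<open>b\<close> form an increasing
  chain with equal ends. So no equation there has slack, which rules out products and losses and
  forces the variables used to touch as well.\<close>

lemma ray_le_of_lin_le:
  assumes Max: "\<kappa> = MaxPPS" and y: "0 \<le> y" "y \<le> q" and b: "lin_pps \<kappa> P y b \<le> b"
    and s: "0 < s" and ys: "\<And>i. q $ i - y $ i \<le> 2 * s * (1 - q $ i)"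
  shows "ray s \<le> b"
proof (rule ccontr)
  assume "\<not> ray s \<le> b"
  then obtain i1 where i1: "b $ i1 < ray s $ i1" by (auto simp: less_eq_vec_def not_le)
  \<comment> \<open>The least parameter for which \<open>ray t \<le> b\<close>, attained at
    \<open>i2\<close>.\<close>
  define t where "t = Max (range (\<lambda>i. (q $ i - b $ i) / (1 - q $ i)))"
  have vpos: "0 < 1 - q $ i" for i using q_less_one[of i] by simp
  have "s < (q $ i1 - b $ i1) / (1 - q $ i1)"
    using i1 vpos[of i1] by (simp add: ray_nth less_divide_eq)
  also have "\<dots> \<le> t" by (simp add: t_def)
  finally have t: "s < t" .
  have "(q $ i - b $ i) / (1 - q $ i) \<le> t" for i by (simp add: t_def)
  then have ray_le: "ray t \<le> b"
    using vpos by (simp add: less_eq_vec_def ray_nth divide_le_eq) (smt (verit))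
  have "t \<in> range (\<lambda>i. (q $ i - b $ i) / (1 - q $ i))" unfolding t_def by (intro Max_in) auto
  then obtain i2 where i2: "t = (q $ i2 - b $ i2) / (1 - q $ i2)" by blast
  define T where "T = {i. b $ i = ray t $ i}"
  have "t * (1 - q $ i2) = q $ i2 - b $ i2" unfolding i2 using vpos[of i2] by simp
  then have "i2 \<in> T" by (simp add: T_def ray_nth)
  have lin_le: "lin_rhs \<kappa> (P i) y b \<le> b $ i" for i
    using b by (simp add: lin_pps_def less_eq_vec_def)
  have lin_mono: "lin_rhs \<kappa> (P i) y (ray t) \<le> lin_rhs \<kappa> (P i) y b" for i
    by (rule lin_rhs_mono[OF wf y(1) ray_le])
  show False
  proof (rule no_closed_lossless_set[of T])
    show "T \<noteq> {}" using \<open>i2 \<in> T\<close> by blast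
  next
    fix i a0 a assume i: "i \<in> T" and L: "P i = FormL a0 a"
    let ?a = "\<lambda>j. real_of_rat (a j)"
    have bi: "b $ i = ray t $ i" using i by (simp add: T_def)
    have "t * (1 - (of_rat a0 + (\<Sum>j\<in>UNIV. ?a j))) \<le> 0"
      using lin_ray_L[OF L, of y t] lin_le[of i] lin_mono[of i] bi by linarith
    then have "1 \<le> of_rat a0 + (\<Sum>j\<in>UNIV. ?a j)" using t s by (simp add: mult_le_0_iff)
    then have sum1: "of_rat a0 + (\<Sum>j\<in>UNIV. ?a j) = 1" using snf_ppsD(3)[OF wf L] by linarith
    have "lin_rhs \<kappa> (P i) y b - lin_rhs \<kappa> (P i) y (ray t) = (\<Sum>j\<in>UNIV. ?a j * (b $ j - ray t $ j))"
      by (simp add: L right_diff_distrib sum_subtractf)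
    then have "(\<Sum>j\<in>UNIV. ?a j * (b $ j - ray t $ j)) \<le> 0"
      using lin_ray_L[OF L, of y t] lin_le[of i] sum1 bi by simp
    then have "b $ j - ray t $ j = 0" if "a j \<noteq> 0" for j
      using weighted_sum_zero_support[of ?a "\<lambda>j. b $ j - ray t $ j" j]
        snf_ppsD(2)[OF wf L] ray_le that by (simp add: less_eq_vec_def)
    then show "of_rat a0 + (\<Sum>j\<in>UNIV. ?a j) = 1 \<and> (\<forall>j. a j \<noteq> 0 \<longrightarrow> j \<in> T)"
      using sum1 by (simp add: T_def)
  next
    fix i j k assume i: "i \<in> T"
    show "P i \<noteq> FormQ j k"
    proof
      assume Q: "P i = FormQ j k"
      have ys': "q $ i - y $ i \<le> 2 * t * (1 - q $ i)" for i
        using ys[of i] t vpos[of i] mult_right_mono[of "2 * s" "2 * t" "1 - q $ i"] by linarith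
      have "(q $ j - y $ j) * (q $ k - y $ k) < t * ((1 - q $ j) * (1 - q $ k)
          + (q $ j - y $ j) * (1 - q $ k) + (q $ k - y $ k) * (1 - q $ j))"
        using y s t ys' vpos by (intro ray_Q_slack) (auto simp: less_eq_vec_def)
      then show False
        using lin_ray_Q[OF Q, of y t] lin_le[of i] lin_mono[of i] i by (simp add: T_def)
    qed
  next
    fix i j k l assume i: "i \<in> T" and M: "P i = FormM j k" and l: "l \<in> {j, k}" "q $ l = q $ i"
    \<comment> \<open>An argument of the maximum with the same value of \<open>q\<close> has the
      same ray coordinate, so it is squeezed between the ray and \<open>b $ i\<close>.\<close>
    have "b $ l \<le> b $ i" using lin_le[of i] M Max l by auto
    also have "\<dots> = ray t $ l" using i l by (simp add: T_def ray_nth)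
    finally show "l \<in> T" using ray_le by (auto simp: T_def less_eq_vec_def intro: antisym)
  qed (use Max in simp)
qed

text \<open>The mirror image, moving from \<open>q\<close> in the direction of the all-ones vector
  and possibly past it. With parameter \<open>- t\<close> the gain and the linearization error of a
  product are both on the losing side, so any \<open>t > 0\<close> will do.\<close>

lemma le_lfp_of_le_lin:
  assumes Min: "\<kappa> = MinPPS" and y: "0 \<le> y" "y \<le> q" and b: "b \<le> lin_pps \<kappa> P y b"
  shows "b \<le> q"
proof (rule ccontr)
  assume "\<not> b \<le> q"
  then obtain i1 where i1: "q $ i1 < b $ i1" by (auto simp: less_eq_vec_def not_le)
  define t where "t = Max (range (\<lambda>i. (b $ i - q $ i) / (1 - q $ i)))"
  have vpos: "0 < 1 - q $ i" for i using q_less_one[of i] by simp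
  have "0 < (b $ i1 - q $ i1) / (1 - q $ i1)"
    using i1 vpos[of i1] by simp
  also have "\<dots> \<le> t" by (simp add: t_def)
  finally have t: "0 < t" .
  have "(b $ i - q $ i) / (1 - q $ i) \<le> t" for i by (simp add: t_def)
  then have le_ray: "b \<le> ray (- t)"
    using vpos by (simp add: less_eq_vec_def ray_nth divide_le_eq) (smt (verit))
  have "t \<in> range (\<lambda>i. (b $ i - q $ i) / (1 - q $ i))" unfolding t_def by (intro Max_in) auto
  then obtain i2 where i2: "t = (b $ i2 - q $ i2) / (1 - q $ i2)" by blast
  define T where "T = {i. b $ i = ray (- t) $ i}"
  have "t * (1 - q $ i2) = b $ i2 - q $ i2" unfolding i2 using vpos[of i2] by simp
  then have "i2 \<in> T" by (simp add: T_def ray_nth)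
  have le_lin: "b $ i \<le> lin_rhs \<kappa> (P i) y b" for i
    using b by (simp add: lin_pps_def less_eq_vec_def)
  have lin_mono: "lin_rhs \<kappa> (P i) y b \<le> lin_rhs \<kappa> (P i) y (ray (- t))" for i
    by (rule lin_rhs_mono[OF wf y(1) le_ray])
  show False
  proof (rule no_closed_lossless_set[of T])
    show "T \<noteq> {}" using \<open>i2 \<in> T\<close> by blast
  next
    fix i a0 a assume i: "i \<in> T" and L: "P i = FormL a0 a"
    let ?a = "\<lambda>j. real_of_rat (a j)"
    have bi: "b $ i = ray (- t) $ i" using i by (simp add: T_def)
    have "t * (1 - (of_rat a0 + (\<Sum>j\<in>UNIV. ?a j))) \<le> 0"
      using lin_ray_L[OF L, of y "- t"] le_lin[of i] lin_mono[of i] bi by linarith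
    then have "1 \<le> of_rat a0 + (\<Sum>j\<in>UNIV. ?a j)" using t by (simp add: mult_le_0_iff)
    then have sum1: "of_rat a0 + (\<Sum>j\<in>UNIV. ?a j) = 1" using snf_ppsD(3)[OF wf L] by linarith
    have "lin_rhs \<kappa> (P i) y (ray (- t)) - lin_rhs \<kappa> (P i) y b
        = (\<Sum>j\<in>UNIV. ?a j * (ray (- t) $ j - b $ j))"
      by (simp add: L right_diff_distrib sum_subtractf)
    then have "(\<Sum>j\<in>UNIV. ?a j * (ray (- t) $ j - b $ j)) \<le> 0"
      using lin_ray_L[OF L, of y "- t"] le_lin[of i] sum1 bi by simp
    then have "ray (- t) $ j - b $ j = 0" if "a j \<noteq> 0" for j
      using weighted_sum_zero_support[of ?a "\<lambda>j. ray (- t) $ j - b $ j" j]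
        snf_ppsD(2)[OF wf L] le_ray that by (simp add: less_eq_vec_def)
    then show "of_rat a0 + (\<Sum>j\<in>UNIV. ?a j) = 1 \<and> (\<forall>j. a j \<noteq> 0 \<longrightarrow> j \<in> T)"
      using sum1 by (simp add: T_def)
  next
    fix i j k assume i: "i \<in> T"
    show "P i \<noteq> FormQ j k"
    proof
      assume Q: "P i = FormQ j k"
      have "0 < (1 - q $ j) * (1 - q $ k)" using vpos by simp
      moreover have "0 \<le> (q $ j - y $ j) * (1 - q $ k)" "0 \<le> (q $ k - y $ k) * (1 - q $ j)"
        "0 \<le> (q $ j - y $ j) * (q $ k - y $ k)"
        using y(2) vpos by (auto simp: less_eq_vec_def less_imp_le)
      ultimately have "0 < t * ((1 - q $ j) * (1 - q $ k)
          + (q $ j - y $ j) * (1 - q $ k) + (q $ k - y $ k) * (1 - q $ j))"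
        using t by simp
      then show False
        using lin_ray_Q[OF Q, of y "- t"] le_lin[of i] lin_mono[of i] i
          \<open>0 \<le> (q $ j - y $ j) * (q $ k - y $ k)\<close> by (simp add: T_def)
    qed
  next
    fix i j k assume i: "i \<in> T" and M: "P i = FormM j k"
    \<comment> \<open>For \<open>t > 1\<close> the map giving \<open>ray (- t)\<close> reverses the
      order, so \<open>lin_ray_M\<close> cannot be used; the argument attaining the minimum at
      \<open>q\<close> is followed instead.\<close>
    obtain l where l: "l \<in> {j, k}" "q $ l = q $ i"
      using eval_q_M[OF M] Min by (auto simp: min_def split: if_splits)
    have "ray (- t) $ l = b $ i" using i l by (simp add: T_def ray_nth)
    also have "b $ i \<le> b $ l" using le_lin[of i] M Min l by auto
    finally have "l \<in> T" using le_ray by (auto simp: T_def less_eq_vec_def intro: antisym)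
    then show "\<exists>l\<in>{j, k}. q $ l = q $ i \<and> l \<in> T" using l by blast
  qed (use Min in simp)
qed

section \<open>Existence, uniqueness and accuracy of the Newton step\<close>

lemma lin_q_le: "y \<le> q \<Longrightarrow> lin_pps \<kappa> P y q \<le> q"
proof -
  assume y: "y \<le> q"
  have "lin_rhs \<kappa> (P i) y q \<le> q $ i" for i
  proof (cases "P i")
    case (FormQ j k)
    \<comment> \<open>This product is exactly the amount by which the linearization at
      \<open>q\<close> falls short of \<open>q $ i\<close>.\<close>
    have "0 \<le> (q $ j - y $ j) * (q $ k - y $ k)" using y by (auto simp: less_eq_vec_def)
    then show ?thesis using eval_q_Q[OF FormQ] FormQ by (simp add: algebra_simps)
  qed (use eval_q[of i] in simp_all)
  then show ?thesis by (simp add: lin_pps_def less_eq_vec_def)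
qed

text \<open>Supplies a ray point that bounds the feasible set below (maxPPS) or shows that it is
  nonempty (minPPS).\<close>

lemma exists_ray_scale: "\<exists>s>0. \<forall>i. q $ i - y $ i \<le> 2 * s * (1 - q $ i)"
proof -
  let ?r = "\<lambda>i. (q $ i - y $ i) / (1 - q $ i)"
  define s where "s = max 1 (Max (range ?r))"
  have "?r i \<le> 2 * s" for i
  proof -
    have "?r i \<le> Max (range ?r)" by simp
    also have "\<dots> \<le> s" by (simp add: s_def)
    also have "\<dots> \<le> 2 * s" by (simp add: s_def max_def)
    finally show ?thesis .
  qed
  then have "q $ i - y $ i \<le> 2 * s * (1 - q $ i)" for i
    using q_less_one[of i] by (simp add: divide_le_eq)
  moreover have "0 < s" by (simp add: s_def)
  ultimately show ?thesis by blast
qed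

text \<open>By monotonicity of the linearized system the feasible set contains its infimum (maxPPS)
  or supremum (minPPS). That point is the only optimum, and the comparison lemmas place it between
  the ray and \<open>q\<close>.\<close>

lemma gnm_optimal_exists:
  assumes y: "0 \<le> y" "y \<le> q"
  shows "\<exists>a. (\<forall>b. gnm_optimal \<kappa> P y b \<longleftrightarrow> b = a) \<and> a \<le> q \<and>
    (\<forall>s>0. (\<forall>i. q $ i - y $ i \<le> 2 * s * (1 - q $ i)) \<longrightarrow> ray s \<le> a)"
proof (cases \<kappa>)
  case MaxPPS
  define F where "F = {b. lin_pps \<kappa> P y b \<le> b}"
  define a :: "real ^ 'n" where "a = (\<chi> i. INF b\<in>F. b $ i)"
  have qF: "q \<in> F" using lin_q_le[OF y(2)] by (simp add: F_def)
  have rayF: "ray s \<le> b" if "b \<in> F" "0 < s" "\<forall>i. q $ i - y $ i \<le> 2 * s * (1 - q $ i)" for s b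
    using that by (intro ray_le_of_lin_le[OF MaxPPS y]) (auto simp: F_def)
  obtain s where s: "0 < s" "\<forall>i. q $ i - y $ i \<le> 2 * s * (1 - q $ i)"
    using exists_ray_scale by blast
  have bdd: "bdd_below ((\<lambda>x. x $ i) ` F)" for i
    using rayF[OF _ s] by (intro bdd_belowI[of _ "ray s $ i"]) (auto simp: less_eq_vec_def)
  have a_le: "a \<le> w" if "w \<in> F" for w
    using that bdd by (auto simp: a_def less_eq_vec_def intro: cINF_lower)
  have le_a: "w \<le> a" if "\<And>u. u \<in> F \<Longrightarrow> w \<le> u" for w
    using that qF by (auto simp: a_def less_eq_vec_def intro!: cINF_greatest)
  have "lin_pps \<kappa> P y a \<le> a"
  proof (rule le_a)
    fix u assume u: "u \<in> F"
    have "lin_pps \<kappa> P y a \<le> lin_pps \<kappa> P y u"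
      using lin_rhs_mono[OF wf y(1) a_le[OF u]] by (simp add: lin_pps_def less_eq_vec_def)
    then show "lin_pps \<kappa> P y a \<le> u" using u by (auto simp: F_def intro: order_trans)
  qed
  then have aF: "a \<in> F" by (simp add: F_def)
  have opt: "gnm_optimal \<kappa> P y b \<longleftrightarrow> b \<in> F \<and> (\<forall>c\<in>F. (\<Sum>i\<in>UNIV. b $ i) \<le> (\<Sum>i\<in>UNIV. c $ i))" for b
    using MaxPPS by (auto simp: F_def)
  have "gnm_optimal \<kappa> P y a" using a_le aF by (auto simp: opt less_eq_vec_def intro: sum_mono)
  moreover have "b = a" if "gnm_optimal \<kappa> P y b" for b
    using that aF eq_of_le_of_sum_le[of a b] a_le[of b] by (auto simp: opt)
  ultimately show ?thesis using a_le[OF qF] le_a rayF by (intro exI[of _ a]) blast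
next
  case MinPPS
  define F where "F = {b. b \<le> lin_pps \<kappa> P y b}"
  define a :: "real ^ 'n" where "a = (\<chi> i. SUP b\<in>F. b $ i)"
  have rayF: "ray s \<in> F" if "0 < s" "\<forall>i. q $ i - y $ i \<le> 2 * s * (1 - q $ i)" for s
    using that ray_le_lin_ray[OF y(2)] by (auto simp: F_def)
  obtain s where s: "0 < s" "\<forall>i. q $ i - y $ i \<le> 2 * s * (1 - q $ i)"
    using exists_ray_scale by blast
  have F_le: "b \<le> q" if "b \<in> F" for b
    using that le_lfp_of_le_lin[OF MinPPS y] by (auto simp: F_def)
  have bdd: "bdd_above ((\<lambda>x. x $ i) ` F)" for i
    using F_le by (intro bdd_aboveI[of _ "q $ i"]) (auto simp: less_eq_vec_def)
  have le_a: "w \<le> a" if "w \<in> F" for w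
    using that bdd by (auto simp: a_def less_eq_vec_def intro: cSUP_upper)
  have a_le: "a \<le> w" if "\<And>u. u \<in> F \<Longrightarrow> u \<le> w" for w
    using that rayF[OF s] by (auto simp: a_def less_eq_vec_def intro!: cSUP_least)
  have "a \<le> lin_pps \<kappa> P y a"
  proof (rule a_le)
    fix u assume u: "u \<in> F"
    have "lin_pps \<kappa> P y u \<le> lin_pps \<kappa> P y a"
      using lin_rhs_mono[OF wf y(1) le_a[OF u]] by (simp add: lin_pps_def less_eq_vec_def)
    then show "u \<le> lin_pps \<kappa> P y a" using u by (auto simp: F_def intro: order_trans)
  qed
  then have aF: "a \<in> F" by (simp add: F_def)
  have opt: "gnm_optimal \<kappa> P y b \<longleftrightarrow> b \<in> F \<and> (\<forall>c\<in>F. (\<Sum>i\<in>UNIV. c $ i) \<le> (\<Sum>i\<in>UNIV. b $ i))" for b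
    using MinPPS by (auto simp: F_def)
  have "gnm_optimal \<kappa> P y a" using le_a aF by (auto simp: opt less_eq_vec_def intro: sum_mono)
  moreover have "b = a" if "gnm_optimal \<kappa> P y b" for b
    using that aF eq_of_le_of_sum_le[of b a] le_a[of b] by (auto simp: opt)
  ultimately show ?thesis using F_le[OF aF] le_a rayF by (intro exI[of _ a]) blast
qed

lemma gnm_step_properties:
  assumes y: "0 \<le> y" "y \<le> q"
  shows gnm_optimal_ex1: "\<exists>!a. gnm_optimal \<kappa> P y a"
    and gnm_step_le: "gnm_step \<kappa> P y \<le> q"
    and gnm_step_halves: "\<lbrakk>0 < s; \<And>i. q $ i - y $ i \<le> 2 * s * (1 - q $ i)\<rbrakk>
      \<Longrightarrow> q $ i - gnm_step \<kappa> P y $ i \<le> s * (1 - q $ i)"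
proof -
  obtain a where a: "\<And>b. gnm_optimal \<kappa> P y b \<longleftrightarrow> b = a" "a \<le> q"
    "\<And>s. 0 < s \<Longrightarrow> \<forall>i. q $ i - y $ i \<le> 2 * s * (1 - q $ i) \<Longrightarrow> ray s \<le> a"
    using gnm_optimal_exists[OF y] by blast
  have eq: "gnm_step \<kappa> P y = a" by (simp add: gnm_step_def a(1))
  show "\<exists>!a. gnm_optimal \<kappa> P y a" by (simp add: a(1))
  show "gnm_step \<kappa> P y \<le> q" by (simp add: eq a(2))
  show "q $ i - gnm_step \<kappa> P y $ i \<le> s * (1 - q $ i)"
    if "0 < s" "\<And>i. q $ i - y $ i \<le> 2 * s * (1 - q $ i)"
    using a(3)[of s] that by (simp add: eq less_eq_vec_def ray_nth diff_le_eq add.commute)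
qed

section \<open>Convergence of the rounded iteration\<close>

lemma rgnm_bounds: "0 \<le> rgnm \<kappa> P h k \<and> rgnm \<kappa> P h k \<le> q"
proof (induction k)
  case 0
  then show ?case using lfp by (simp add: is_lfp_def)
next
  case (Suc k)
  have "grid_floor h (gnm_step \<kappa> P (rgnm \<kappa> P h k) $ i) \<le> q $ i" for i
  proof -
    have "gnm_step \<kappa> P (rgnm \<kappa> P h k) $ i \<le> q $ i"
      using gnm_step_le Suc by (auto simp: less_eq_vec_def)
    then have "max 0 (gnm_step \<kappa> P (rgnm \<kappa> P h k) $ i) \<le> q $ i"
      using q_pos[of i] by simp
    then show ?thesis using grid_floor_le order_trans by blast
  qed
  then show ?case by (simp add: less_eq_vec_def grid_floor_nonneg)
qed

text \<open>In units of \<open>1 - q\<close> the error starts at \<open>2 ^ B\<close> at most, is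
  halved by each step, and then grows by at most \<open>2 ^ B / 2 ^ h\<close> through rounding. The
  second summand is the fixed point of this recurrence.\<close>

lemma rgnm_error:
  assumes gap: "\<And>i. 1 / 2 ^ B \<le> 1 - q $ i"
  shows "q $ i - rgnm \<kappa> P h k $ i \<le> (2 ^ B / 2 ^ k + 2 * 2 ^ B / 2 ^ h) * (1 - q $ i)"
proof (induction k arbitrary: i)
  case 0
  have "q $ i \<le> 1" using q_less_one[of i] by simp
  also have "1 \<le> 2 ^ B * (1 - q $ i)" using gap[of i] by (simp add: divide_le_eq mult.commute)
  also have "\<dots> \<le> (2 ^ B / 2 ^ 0 + 2 * 2 ^ B / 2 ^ h) * (1 - q $ i)"
    using q_less_one[of i] by (intro mult_right_mono) auto
  finally show ?case by simp
next
  case (Suc k)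
  define s :: real where "s = (2 ^ B / 2 ^ k + 2 * 2 ^ B / 2 ^ h) / 2"
  have two_s: "2 * s = 2 ^ B / 2 ^ k + 2 * 2 ^ B / 2 ^ h" by (simp add: s_def)
  have "0 < s" by (simp add: s_def add_pos_pos)
  moreover have "q $ i - rgnm \<kappa> P h k $ i \<le> 2 * s * (1 - q $ i)" for i
    using Suc.IH[of i] by (simp only: two_s)
  ultimately have "q $ i - gnm_step \<kappa> P (rgnm \<kappa> P h k) $ i \<le> s * (1 - q $ i)"
    using gnm_step_halves rgnm_bounds by blast
  moreover have "gnm_step \<kappa> P (rgnm \<kappa> P h k) $ i - 1 / 2 ^ h \<le> rgnm \<kappa> P h (Suc k) $ i"
    by (simp add: grid_floor_ge)
  moreover have "1 / 2 ^ h \<le> 2 ^ B / 2 ^ h * (1 - q $ i)"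
    using gap[of i] by (simp add: field_simps)
  ultimately have "q $ i - rgnm \<kappa> P h (Suc k) $ i \<le> s * (1 - q $ i) + 2 ^ B / 2 ^ h * (1 - q $ i)"
    by linarith
  also have "\<dots> = (2 ^ B / 2 ^ Suc k + 2 * 2 ^ B / 2 ^ h) * (1 - q $ i)"
    by (simp add: s_def field_simps)
  finally show ?case .
qed

end

section \<open>A lower bound for the distance of the least fixed point to 1\<close>

definition denom :: "rat \<Rightarrow> int" where
  "denom r = snd (quotient_of r)"

lemma denom_pos: "0 < denom r"
  by (simp add: denom_def quotient_of_denom_pos')

lemma denom_mult_Ints: "of_int (denom r) * real_of_rat r \<in> \<int>"
proof -
  obtain p d where pd: "quotient_of r = (p, d)" by force
  have "0 < d" using quotient_of_denom_pos[OF pd] .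
  moreover have "real_of_rat r = of_int p / of_int d"
    using quotient_of_div[OF pd] by (simp add: of_rat_divide)
  ultimately have "of_int (denom r) * real_of_rat r = of_int p" by (simp add: denom_def pd)
  then show ?thesis by simp
qed

lemma denom_le_rat_size: "denom r \<le> 2 ^ rat_size r"
proof -
  obtain p d where pd: "quotient_of r = (p, d)" by force
  have "d < 2 ^ nat (bitlen d)" using bitlen_bounds quotient_of_denom_pos[OF pd] by blast
  also have "\<dots> \<le> 2 ^ rat_size r" by (simp add: rat_size_def pd)
  finally show ?thesis by (simp add: denom_def pd)
qed

lemma two_le_rat_size:
  assumes "0 < r"
  shows "2 \<le> rat_size r"
proof -
  obtain p d where pd: "quotient_of r = (p, d)" by force
  have d: "0 < d" using quotient_of_denom_pos[OF pd] .
  have "r = of_int p / of_int d" by (rule quotient_of_div[OF pd])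
  then have p: "0 < p" using assms d by (simp add: zero_less_divide_iff)
  have "1 \<le> bitlen d" "1 \<le> bitlen p"
    using d p bitlen_eq_zero_iff[of d] bitlen_eq_zero_iff[of p] bitlen_nonneg[of d] bitlen_nonneg[of p]
    by linarith+
  then have "1 \<le> nat (bitlen d)" "1 \<le> nat (bitlen p)" by linarith+
  then show ?thesis by (simp add: rat_size_def pd)
qed

text \<open>A product instead of the least common multiple: its bit length is directly bounded by
  the encoding length. Zero coefficients have denominator 1.\<close>

definition common_denom :: "rat \<Rightarrow> ('n::finite \<Rightarrow> rat) \<Rightarrow> int" where
  "common_denom a0 a = denom a0 * (\<Prod>j\<in>UNIV. denom (a j))"

lemma common_denom_pos: "0 < common_denom a0 a"
  by (simp add: common_denom_def denom_pos prod_pos)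

lemma common_denom_mult_Ints:
  "of_int (common_denom a0 a) * real_of_rat a0 \<in> \<int>"
  "of_int (common_denom a0 a) * real_of_rat (a j) \<in> \<int>"
proof -
  have "of_int (common_denom a0 a) * real_of_rat a0
      = of_int (\<Prod>j\<in>UNIV. denom (a j)) * (of_int (denom a0) * real_of_rat a0)"
    by (simp add: common_denom_def)
  then show "of_int (common_denom a0 a) * real_of_rat a0 \<in> \<int>"
    by (simp only: Ints_mult Ints_of_int denom_mult_Ints)
  have "(\<Prod>j\<in>UNIV. denom (a j)) = denom (a j) * (\<Prod>j\<in>UNIV - {j}. denom (a j))"
    by (rule prod.remove) auto
  then have "of_int (common_denom a0 a) * real_of_rat (a j)
      = of_int (denom a0 * (\<Prod>j\<in>UNIV - {j}. denom (a j))) * (of_int (denom (a j)) * real_of_rat (a j))"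
    by (simp add: common_denom_def)
  then show "of_int (common_denom a0 a) * real_of_rat (a j) \<in> \<int>"
    by (simp only: Ints_mult Ints_of_int denom_mult_Ints)
qed

lemma common_denom_le: "common_denom a0 a \<le> 2 ^ rhs_size (FormL a0 a)"
proof -
  have "denom a0 \<le> 2 ^ (if a0 = 0 then 0 else rat_size a0)"
    using denom_le_rat_size[of a0] by (simp add: denom_def)
  moreover have "(\<Prod>j\<in>UNIV. denom (a j)) \<le> 2 ^ (\<Sum>j | a j \<noteq> 0. rat_size (a j) + var_size TYPE('a))"
  proof -
    have "(\<Prod>j\<in>UNIV. denom (a j)) = (\<Prod>j | a j \<noteq> 0. denom (a j))"
      by (rule prod.mono_neutral_right) (auto simp: denom_def)
    also have "\<dots> \<le> (\<Prod>j | a j \<noteq> 0. 2 ^ (rat_size (a j) + var_size TYPE('a)))"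
    proof (intro prod_mono conjI)
      fix j
      show "denom (a j) \<le> 2 ^ (rat_size (a j) + var_size TYPE('a))"
        using denom_le_rat_size[of "a j"] by (rule order_trans) simp
    qed (simp add: denom_pos less_imp_le)
    finally show ?thesis by (simp add: power_sum)
  qed
  ultimately show ?thesis unfolding common_denom_def rhs_size.simps power_add
    by (intro mult_mono) (auto simp: denom_pos less_imp_le intro!: prod_nonneg)
qed

lemma one_le_var_size: "1 \<le> var_size TYPE('n::finite)"
proof -
  have "bitlen (int CARD('n)) \<noteq> 0" by (simp add: bitlen_eq_zero_iff)
  then show ?thesis using bitlen_nonneg[of "int CARD('n)"] by (simp add: var_size_def)
qed

definition one_norm :: "real ^ 'm \<Rightarrow> real" where
  "one_norm x = (\<Sum>c\<in>UNIV. \<bar>x $ c\<bar>)"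

lemma one_norm_axis [simp]: "one_norm (axis c 1) = 1"
  by (simp add: one_norm_def axis_def if_distrib cong: if_cong)

lemma one_norm_zero [simp]: "one_norm 0 = 0"
  by (simp add: one_norm_def)

lemma one_norm_triangle: "one_norm (x + y) \<le> one_norm x + one_norm y"
  by (auto simp: one_norm_def simp flip: sum.distrib intro!: sum_mono)

lemma one_norm_triangle_diff: "one_norm (x - y) \<le> one_norm x + one_norm y"
  by (auto simp: one_norm_def simp flip: sum.distrib intro!: sum_mono)

lemma sum_UNIV_option: "(\<Sum>c\<in>UNIV. f c) = f None + (\<Sum>j\<in>UNIV. f (Some j))"
  for f :: "'n::finite option \<Rightarrow> real"
  by (simp add: UNIV_option_conv sum.reindex)

section \<open>Integral constraints and a small solution\<close>

context snf_lfp_interior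
begin

text \<open>
  The linear constraints are those on the coordinates \<open>w\<^sub>i\<close> (index \<open>Some i\<close>) and \<open>t\<close> (index \<open>None\<close>)
  under which \<open>1 - \<epsilon> w\<close> is a pre-fixed point for small \<open>\<epsilon>\<close>.  Equations of form M contribute
  two constraints for a maximum, and for a minimum the constraint that holds at \<open>q\<close>, twice.
\<close>

definition selected :: "bool \<Rightarrow> 'n \<Rightarrow> 'n \<Rightarrow> 'n" where
  "selected e j k = (if (case \<kappa> of MaxPPS \<Rightarrow> e | MinPPS \<Rightarrow> q $ j \<le> q $ k) then j else k)"

text \<open>Multiplying by the common denominator makes the entries integral. A zero row fills the
  second slot of forms L and Q, so that all constraints are indexed by pairs. The coordinate
  \<open>t\<close> stands for a quantity up to \<open>1 / \<epsilon>\<close>, which keeps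
  \<open>\<epsilon>\<close> out of the coefficients.\<close>

fun row :: "bool \<Rightarrow> 'n \<Rightarrow> 'n snf_rhs \<Rightarrow> real ^ 'n option" where
  "row e i (FormL a0 a) = (if e then 0 else (\<chi> c. of_int (common_denom a0 a) *
     (case c of None \<Rightarrow> 1 - of_rat a0 - (\<Sum>j\<in>UNIV. of_rat (a j))
      | Some j \<Rightarrow> of_rat (a j) - (if j = i then 1 else 0))))"
| "row e i (FormQ j k) =
     (if e then 0 else axis (Some j) 1 + axis (Some k) 1 - axis (Some i) 1)"
| "row e i (FormM j k) = axis (Some (selected e j k)) 1 - axis (Some i) 1"

text \<open>The 1 for products leaves room for the quadratic term
  \<open>\<epsilon> * w $ j * w $ k\<close>.\<close>

fun row_bound :: "bool \<Rightarrow> 'n snf_rhs \<Rightarrow> real" where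
  "row_bound e (FormQ j k) = (if e then 0 else 1)"
| "row_bound e _ = 0"

lemma row_Ints: "row e i (P i) $ c \<in> \<int>"
proof (cases "P i")
  case (FormL a0 a)
  let ?D = "of_int (common_denom a0 a) :: real"
  have "?D * (1 - of_rat a0 - (\<Sum>j\<in>UNIV. of_rat (a j))) \<in> \<int>"
    by (simp only: right_diff_distrib sum_distrib_left mult_1_right)
      (intro Ints_diff Ints_sum common_denom_mult_Ints Ints_of_int)
  moreover have "?D * (of_rat (a j) - (if j = i then 1 else 0)) \<in> \<int>" for j
    by (simp only: right_diff_distrib) (intro Ints_diff common_denom_mult_Ints, simp)
  ultimately show ?thesis using FormL by (auto split: option.split)
qed (auto simp: axis_def)

lemma row_L_inner:
  "row False i (FormL a0 a) \<bullet> x = of_int (common_denom a0 a) *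
    ((1 - of_rat a0 - (\<Sum>j\<in>UNIV. of_rat (a j))) * x $ None
      + (\<Sum>j\<in>UNIV. of_rat (a j) * x $ Some j) - x $ Some i)"
proof -
  have "(\<Sum>j\<in>UNIV. (of_rat (a j) - (if j = i then 1 else 0)) * x $ Some j)
      = (\<Sum>j\<in>UNIV. of_rat (a j) * x $ Some j) - (\<Sum>j\<in>UNIV. if j = i then x $ Some j else 0)"
    unfolding sum_subtractf[symmetric] by (intro sum.cong) (auto simp: left_diff_distrib)
  also have "\<dots> = (\<Sum>j\<in>UNIV. of_rat (a j) * x $ Some j) - x $ Some i" by simp
  finally have *: "(\<Sum>j\<in>UNIV. (of_rat (a j) - (if j = i then 1 else 0)) * x $ Some j)
      = (\<Sum>j\<in>UNIV. of_rat (a j) * x $ Some j) - x $ Some i" .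
  show ?thesis
    by (simp add: inner_vec_def sum_UNIV_option mult.assoc add_diff_eq distrib_left * flip: sum_distrib_left)
qed

text \<open>The lost probability and the coefficients of the equation add up to at most 1, and the
  diagonal entry contributes at most 1 more.\<close>

lemma row_L_norm:
  assumes L: "P i = FormL a0 a"
  shows "one_norm (row False i (P i)) \<le> 2 * of_int (common_denom a0 a)"
proof -
  let ?D = "of_int (common_denom a0 a) :: real"
  let ?a = "\<lambda>j. real_of_rat (a j)"
  let ?e = "\<lambda>j. if j = i then 1 else 0 :: real"
  have D: "0 \<le> ?D" using common_denom_pos[of a0 a] by simp
  note nn = snf_ppsD[OF wf L]
  have "one_norm (row False i (P i)) = ?D * \<bar>1 - of_rat a0 - (\<Sum>j\<in>UNIV. ?a j)\<bar>
      + (\<Sum>j\<in>UNIV. ?D * \<bar>?a j - ?e j\<bar>)"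
    using D by (simp add: L one_norm_def sum_UNIV_option abs_mult)
  also have "\<dots> = ?D * (1 - of_rat a0 - (\<Sum>j\<in>UNIV. ?a j) + (\<Sum>j\<in>UNIV. \<bar>?a j - ?e j\<bar>))"
    using nn(3) by (simp add: sum_distrib_left algebra_simps)
  also have "\<dots> \<le> ?D * (1 - of_rat a0 - (\<Sum>j\<in>UNIV. ?a j) + (\<Sum>j\<in>UNIV. ?a j + ?e j))"
    using D nn(2) by (intro mult_left_mono add_left_mono sum_mono) (auto simp: abs_if)
  also have "\<dots> \<le> ?D * 2"
    using D nn(1) by (intro mult_left_mono) (auto simp: sum.distrib)
  finally show ?thesis by simp
qed

text \<open>An affine equation without nonzero coefficients would force
  \<open>q $ i = 0\<close>.\<close>

lemma two_le_rhs_size: "2 \<le> rhs_size (P i)"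
proof (cases "P i")
  case (FormL a0 a)
  have wfL: "snf_rhs_wf (FormL a0 a)" using wf FormL by (metis snf_pps_def)
  show ?thesis
  proof (cases "a0 = 0")
    case True
    then have "\<exists>j. a j \<noteq> 0" using eval_q_L[OF FormL] q_pos[of i] by (auto intro: ccontr)
    then obtain j where j: "a j \<noteq> 0" by blast
    then have "2 \<le> rat_size (a j)" using wfL by (intro two_le_rat_size) (auto simp: less_le)
    also have "\<dots> \<le> rat_size (a j) + var_size TYPE('n)" by simp
    also have "\<dots> \<le> (\<Sum>j | a j \<noteq> 0. rat_size (a j) + var_size TYPE('n))"
      by (rule member_le_sum) (use j in auto)
    finally show ?thesis using FormL by simp
  next
    case False
    then have "2 \<le> rat_size a0" using wfL by (intro two_le_rat_size) (auto simp: less_le)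
    then show ?thesis using FormL False by simp
  qed
qed (use one_le_var_size[where 'n = 'n] in auto)

definition weight :: "bool \<Rightarrow> 'n \<Rightarrow> real" where
  "weight e i = max 1 (\<bar>row_bound e (P i)\<bar> + one_norm (row e i (P i)))"

text \<open>The leading 2 pays for the constraint \<open>w $ i \<ge> 1\<close>, whose own factor is
  2. The constants are absorbed because each equation has size at least 2.\<close>

lemma weight_bound: "2 * (weight False i * weight True i) \<le> 2 ^ (2 * rhs_size (P i))"
proof -
  have s2: "2 \<le> rhs_size (P i)" by (rule two_le_rhs_size)
  have w: "0 \<le> weight e i" for e by (simp add: weight_def)
  have small: ?thesis if "weight False i * weight True i \<le> 4"
  proof -
    have "2 * (weight False i * weight True i) \<le> 2 ^ 4" using that by simp
    also have "(2::real) ^ 4 \<le> 2 ^ (2 * rhs_size (P i))" using s2 by (intro power_increasing) auto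
    finally show ?thesis .
  qed
  show ?thesis
  proof (cases "P i")
    case (FormL a0 a)
    let ?D = "of_int (common_denom a0 a) :: real"
    have D: "1 \<le> ?D" using common_denom_pos[of a0 a] by simp
    have "?D \<le> of_int (2 ^ rhs_size (P i))"
      unfolding FormL by (intro of_int_le_iff[THEN iffD2] common_denom_le)
    then have D': "?D \<le> 2 ^ rhs_size (P i)" unfolding of_int_power of_int_numeral .
    have "weight False i \<le> 2 * ?D" "weight True i = 1"
      using row_L_norm[OF FormL] D by (simp_all add: weight_def FormL)
    then have "2 * (weight False i * weight True i) \<le> 2 * (2 * ?D)" by simp
    also have "\<dots> \<le> 2 * (2 * 2 ^ rhs_size (P i))" using D' by (intro mult_left_mono) auto
    also have "\<dots> = 2 ^ 2 * 2 ^ rhs_size (P i)" by simp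
    also have "\<dots> = 2 ^ (2 + rhs_size (P i))" by (simp add: power_add)
    also have "(2::real) ^ (2 + rhs_size (P i)) \<le> 2 ^ (2 * rhs_size (P i))"
      using s2 by (intro power_increasing) auto
    finally show ?thesis .
  next
    case (FormQ j k)
    have "one_norm (row False i (P i)) \<le> 3"
      using one_norm_triangle_diff[of "axis (Some j) 1 + axis (Some k) 1" "axis (Some i) 1"]
        one_norm_triangle[of "axis (Some j) 1" "axis (Some k) 1"] by (simp add: FormQ)
    then have "weight False i \<le> 4" "weight True i = 1" by (simp_all add: weight_def FormQ)
    then show ?thesis by (intro small) simp
  next
    case (FormM j k)
    have "weight e i \<le> 2" for e
      using one_norm_triangle_diff[of "axis (Some (selected e j k)) 1" "axis (Some i) 1"]
      by (simp add: weight_def FormM)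
    then have "weight False i * weight True i \<le> 2 * 2" using w by (intro mult_mono) auto
    then show ?thesis by (intro small) simp
  qed
qed

text \<open>For \<open>v = 1 - q\<close>, affine equations give equality, and a product gives
  \<open>v $ j + v $ k - v $ i = v $ j * v $ k \<ge> \<mu>\<^sup>2\<close>. Dividing by
  \<open>\<mu>\<^sup>2\<close> turns this lower bound into 1.\<close>

lemma row_feasible:
  assumes \<mu>: "0 < \<mu>" "\<And>i. \<mu> \<le> 1 - q $ i"
  defines "x \<equiv> (\<chi> c. case c of None \<Rightarrow> 1 / \<mu>\<^sup>2 | Some i \<Rightarrow> (1 - q $ i) / \<mu>\<^sup>2) :: real ^ 'n option"
  shows "row_bound e (P i) \<le> row e i (P i) \<bullet> x"
proof (cases "P i")
  case (FormL a0 a)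
  have "(\<Sum>j\<in>UNIV. real_of_rat (a j) * x $ Some j)
      = ((\<Sum>j\<in>UNIV. of_rat (a j)) - (\<Sum>j\<in>UNIV. of_rat (a j) * q $ j)) / \<mu>\<^sup>2"
    by (simp add: x_def right_diff_distrib sum_subtractf flip: sum_divide_distrib)
  also have "(\<Sum>j\<in>UNIV. of_rat (a j) * q $ j) = q $ i - of_rat a0"
    using eval_q_L[OF FormL] by simp
  finally have "row False i (P i) \<bullet> x = 0"
    unfolding FormL row_L_inner by (simp add: x_def flip: diff_divide_distrib add_divide_distrib)
  then show ?thesis by (cases e) (simp_all add: FormL)
next
  case (FormQ j k)
  have "\<mu>\<^sup>2 \<le> (1 - q $ j) * (1 - q $ k)"
    unfolding power2_eq_square using \<mu> q_less_one by (intro mult_mono) (auto simp: less_imp_le)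
  then have "1 \<le> (1 - q $ j) * (1 - q $ k) / \<mu>\<^sup>2" using \<mu>(1) by simp
  also have "\<dots> = row False i (P i) \<bullet> x"
    using eval_q_Q[OF FormQ]
    by (simp add: FormQ inner_diff_left inner_add_left inner_axis' x_def
        flip: diff_divide_distrib add_divide_distrib) (simp add: algebra_simps)
  finally show ?thesis by (cases e) (simp_all add: FormQ)
next
  case (FormM j k)
  have "q $ selected e j k \<le> q $ i"
    using eval_q_M[OF FormM] unfolding selected_def by (cases \<kappa>) (auto simp: min_def)
  then show ?thesis using \<mu>(1)
    by (simp add: FormM inner_diff_left inner_axis' x_def divide_right_mono)
qed

text \<open>The solution built from \<open>q\<close> is not bounded in terms of the size, but it
  shows that the integral polyhedron is nonempty, which then has a point bounded by the product of
  the weights.\<close>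

lemma exists_small_solution:
  obtains w :: "real ^ 'n" and t :: real
  where "\<And>i. 1 \<le> w $ i" "\<And>i. w $ i \<le> 2 ^ (2 * pps_size P)" "t \<le> 2 ^ (2 * pps_size P)"
    and "\<And>i a0 a. P i = FormL a0 a \<Longrightarrow> w $ i \<le>
      (1 - of_rat a0 - (\<Sum>j\<in>UNIV. of_rat (a j))) * t + (\<Sum>j\<in>UNIV. of_rat (a j) * w $ j)"
    and "\<And>i j k. P i = FormQ j k \<Longrightarrow> w $ i + 1 \<le> w $ j + w $ k"
    and "\<And>i j k. P i = FormM j k \<Longrightarrow> 
      w $ i \<le> (case \<kappa> of MaxPPS \<Rightarrow> min (w $ j) (w $ k) | MinPPS \<Rightarrow> max (w $ j) (w $ k))"
proof -
  define \<mu> where "\<mu> = Min (range (\<lambda>i. 1 - q $ i))"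
  have "\<mu> \<in> range (\<lambda>i. 1 - q $ i)" unfolding \<mu>_def by (intro Min_in) auto
  then have \<mu>0: "0 < \<mu>" and \<mu>1: "\<mu> \<le> 1" using q_pos q_less_one by (auto simp: less_imp_le)
  have \<mu>_le: "\<mu> \<le> 1 - q $ i" for i by (simp add: \<mu>_def)
  have "\<mu>\<^sup>2 \<le> \<mu>" using \<mu>0 \<mu>1 by (simp add: power2_eq_square mult_left_le)
  then have \<mu>2: "\<mu>\<^sup>2 \<le> 1 - q $ i" for i using \<mu>_le[of i] by simp
  define x0 :: "real ^ 'n option" where
    "x0 = (\<chi> c. case c of None \<Rightarrow> 1 / \<mu>\<^sup>2 | Some i \<Rightarrow> (1 - q $ i) / \<mu>\<^sup>2)"
  define A :: "'n option + 'n \<times> bool \<Rightarrow> real ^ 'n option" where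
    "A = case_sum (\<lambda>c. axis c 1) (\<lambda>(i, e). row e i (P i))"
  define b :: "'n option + 'n \<times> bool \<Rightarrow> real" where
    "b = case_sum (\<lambda>c. case c of None \<Rightarrow> 0 | Some i \<Rightarrow> 1) (\<lambda>(i, e). row_bound e (P i))"
  have int: "A l $ c \<in> \<int>" for l c
    by (auto simp: A_def row_Ints axis_def split: sum.split)
  have feas: "b l \<le> A l \<bullet> x0" for l
  proof (cases l)
    case (Inl c)
    then show ?thesis using \<mu>0 \<mu>2
      by (cases c) (auto simp: A_def b_def inner_axis' x0_def)
  next
    case (Inr p)
    then show ?thesis using row_feasible[OF \<mu>0 \<mu>_le, folded x0_def]
      by (cases p) (simp add: A_def b_def)
  qed
  \<comment> \<open>The bounds \<open>w $ i \<ge> 1\<close> and \<open>t \<ge> 0\<close> have the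
    unit vectors as rows.\<close>
  have "Basis \<subseteq> range A"
  proof
    fix v :: "real ^ 'n option" assume "v \<in> Basis"
    then obtain c where "v = axis c 1" by (auto simp: Basis_vec_def)
    then have "v = A (Inl c)" by (simp add: A_def)
    then show "v \<in> range A" by blast
  qed
  then have spanA: "span (range A) = UNIV"
    using span_mono[of Basis "range A"] by (simp add: top.extremum_unique)
  obtain x where x: "\<And>l. b l \<le> A l \<bullet> x"
    and xb: "\<And>c. \<bar>x $ c\<bar> \<le> (\<Prod>l\<in>UNIV. max 1 (\<bar>b l\<bar> + (\<Sum>c\<in>UNIV. \<bar>A l $ c\<bar>)))"
    using integral_polyhedron_bounded_point[OF int feas spanA] by blast
  have "(\<Prod>l\<in>UNIV. max 1 (\<bar>b l\<bar> + one_norm (A l)))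
      = (\<Prod>c\<in>UNIV. max 1 (\<bar>b (Inl c)\<bar> + one_norm (A (Inl c))))
        * (\<Prod>p\<in>UNIV. max 1 (\<bar>b (Inr p)\<bar> + one_norm (A (Inr p))))"
    by (simp add: prod.Plus flip: UNIV_Plus_UNIV)
  \<comment> \<open>The constraint \<open>t \<ge> 0\<close> contributes the factor 1, each
    \<open>w $ i \<ge> 1\<close> a factor 2.\<close>
  also have "(\<Prod>c\<in>UNIV. max 1 (\<bar>b (Inl c)\<bar> + one_norm (A (Inl c)))) = (\<Prod>i::'n\<in>UNIV. 2)"
    by (simp add: UNIV_option_conv prod.reindex A_def b_def)
  also have "(\<Prod>p\<in>UNIV. max 1 (\<bar>b (Inr p)\<bar> + one_norm (A (Inr p))))
      = (\<Prod>i\<in>UNIV. \<Prod>e\<in>UNIV. weight e i)"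
    by (simp add: prod.cartesian_product A_def b_def weight_def case_prod_beta flip: UNIV_Times_UNIV)
  also have "\<dots> = (\<Prod>i\<in>UNIV. weight False i * weight True i)" by (simp add: UNIV_bool)
  also have "(\<Prod>i::'n\<in>UNIV. 2) * \<dots> = (\<Prod>i\<in>UNIV. 2 * (weight False i * weight True i))"
    by (simp add: prod.distrib)
  also have "\<dots> \<le> (\<Prod>i\<in>UNIV. 2 ^ (2 * rhs_size (P i)))"
    by (intro prod_mono conjI weight_bound) (auto simp: weight_def)
  also have "\<dots> = 2 ^ (2 * pps_size P)"
    by (simp add: pps_size_def sum_distrib_left flip: power_sum)
  finally have le: "x $ c \<le> 2 ^ (2 * pps_size P)" for c
    using xb[of c] by (simp add: one_norm_def) 
  have rowx: "row_bound e (P i) \<le> row e i (P i) \<bullet> x" for i e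
    using x[of "Inr (i, e)"] by (simp add: A_def b_def)
  show ?thesis
  proof (rule that[of "\<chi> i. x $ Some i" "x $ None"]; (unfold vec_lambda_beta)?)
    show "1 \<le> x $ Some i" for i
      using x[of "Inl (Some i)"] by (simp add: A_def b_def inner_axis')
  next
    fix i a0 a assume L: "P i = FormL a0 a"
    have "0 \<le> row False i (FormL a0 a) \<bullet> x" using rowx[of False i] by (simp add: L)
    then show "x $ Some i \<le> (1 - of_rat a0 - (\<Sum>j\<in>UNIV. of_rat (a j))) * x $ None
        + (\<Sum>j\<in>UNIV. of_rat (a j) * x $ Some j)"
      unfolding row_L_inner using common_denom_pos[of a0 a] by (simp add: zero_le_mult_iff)
  next
    fix i j k assume "P i = FormQ j k"
    then show "x $ Some i + 1 \<le> x $ Some j + x $ Some k"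
      using rowx[of False i] by (simp add: inner_diff_left inner_add_left inner_axis')
  next
    fix i j k assume M: "P i = FormM j k"
    have "x $ Some i \<le> x $ Some (selected e j k)" for e
      using rowx[of e i] by (simp add: M inner_diff_left inner_axis')
    note this[of True] this[of False]
    then show "x $ Some i \<le> (case \<kappa> of
        MaxPPS \<Rightarrow> min (x $ Some j) (x $ Some k) | MinPPS \<Rightarrow> max (x $ Some j) (x $ Some k))"
      unfolding selected_def by (cases \<kappa>) (auto simp: le_max_iff_disj split: if_splits)
  qed (rule le)+
qed

text \<open>With \<open>\<epsilon> = 1 / K\<^sup>2\<close> the numbers
  \<open>\<epsilon> * w $ j * w $ k\<close>, \<open>\<epsilon> * t\<close> and
  \<open>\<epsilon> * w $ i\<close> are at most 1, so \<open>1 - \<epsilon> w\<close> is a pre-fixed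
  point in the unit cube. As \<open>w \<ge> 1\<close>, the gap is at least
  \<open>\<epsilon>\<close>; squaring \<open>K\<close> turns the exponent \<open>2 |P|\<close> into
  \<open>4 |P|\<close>.\<close>

lemma one_minus_lfp_ge: "1 / 2 ^ (4 * pps_size P) \<le> 1 - q $ i"
proof -
  define K :: real where "K = 2 ^ (2 * pps_size P)"
  define \<epsilon> where "\<epsilon> = 1 / K\<^sup>2"
  have K1: "1 \<le> K" by (simp add: K_def)
  have \<epsilon>0: "0 < \<epsilon>" using K1 by (simp add: \<epsilon>_def)
  obtain w t where w1: "\<And>i. 1 \<le> w $ i" and wK: "\<And>i. w $ i \<le> K" and tK: "t \<le> K"
    and L: "\<And>i a0 a. P i = FormL a0 a \<Longrightarrow> w $ i \<le>
      (1 - of_rat a0 - (\<Sum>j\<in>UNIV. of_rat (a j))) * t + (\<Sum>j\<in>UNIV. of_rat (a j) * w $ j)"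
    and Q: "\<And>i j k. P i = FormQ j k \<Longrightarrow> w $ i + 1 \<le> w $ j + w $ k"
    and M: "\<And>i j k. P i = FormM j k \<Longrightarrow>
      w $ i \<le> (case \<kappa> of MaxPPS \<Rightarrow> min (w $ j) (w $ k) | MinPPS \<Rightarrow> max (w $ j) (w $ k))"
    by (rule exists_small_solution[folded K_def]) (rule that)
  have \<epsilon>K: "\<epsilon> * u \<le> 1" if "u \<le> K" for u
  proof -
    have "\<epsilon> * u \<le> \<epsilon> * K\<^sup>2"
      using that K1 \<epsilon>0 self_le_power[of K 2] by (intro mult_left_mono) auto
    also have "\<dots> = 1" using K1 by (simp add: \<epsilon>_def)
    finally show ?thesis .
  qed
  define x :: "real ^ 'n" where "x = (\<chi> i. 1 - \<epsilon> * w $ i)"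
  have "eval_rhs \<kappa> (P i) x \<le> x $ i" for i
  proof (cases "P i")
    case (FormL a0 a)
    define c where "c = 1 - real_of_rat a0 - (\<Sum>j\<in>UNIV. of_rat (a j))"
    have c: "0 \<le> c" using snf_ppsD(3)[OF wf FormL] by (simp add: c_def)
    have "\<epsilon> * w $ i \<le> \<epsilon> * (c * t + (\<Sum>j\<in>UNIV. of_rat (a j) * w $ j))"
      using L[OF FormL] \<epsilon>0 unfolding c_def by (intro mult_left_mono) auto
    also have "\<dots> = c * (\<epsilon> * t) + \<epsilon> * (\<Sum>j\<in>UNIV. of_rat (a j) * w $ j)"
      by (simp add: algebra_simps)
    also have "c * (\<epsilon> * t) \<le> c * 1" using c \<epsilon>K[OF tK] by (rule mult_left_mono[rotated])
    finally have "\<epsilon> * w $ i \<le> c + \<epsilon> * (\<Sum>j\<in>UNIV. of_rat (a j) * w $ j)" by simp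
    moreover have "(\<Sum>j\<in>UNIV. of_rat (a j) * x $ j)
        = (\<Sum>j\<in>UNIV. of_rat (a j)) - \<epsilon> * (\<Sum>j\<in>UNIV. of_rat (a j) * w $ j)"
      by (simp add: x_def right_diff_distrib sum_subtractf sum_distrib_left mult.left_commute)
    ultimately show ?thesis by (simp add: FormL x_def c_def)
  next
    case (FormQ j k)
    have "w $ j * w $ k \<le> K * K" using w1 wK K1 by (intro mult_mono) (auto intro: order_trans[of 0 1])
    then have "\<epsilon> * (w $ j * w $ k) \<le> \<epsilon> * (K * K)" using \<epsilon>0 by (intro mult_left_mono) auto
    also have "\<dots> = 1" using K1 by (simp add: \<epsilon>_def power2_eq_square)
    also have "1 \<le> w $ j + w $ k - w $ i" using Q[OF FormQ] by simp
    finally have "\<epsilon> * (\<epsilon> * (w $ j * w $ k)) \<le> \<epsilon> * (w $ j + w $ k - w $ i)"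
      using \<epsilon>0 by (intro mult_left_mono) auto
    then show ?thesis by (simp add: FormQ x_def algebra_simps)
  next
    case (FormM j k)
    have "\<epsilon> * w $ i \<le> \<epsilon> * w $ l \<longleftrightarrow> w $ i \<le> w $ l" for l using \<epsilon>0 by simp
    then show ?thesis using M[OF FormM] FormM
      by (cases \<kappa>) (auto simp: x_def min_le_iff_disj le_max_iff_disj)
  qed
  moreover have "0 \<le> x" using \<epsilon>K[OF wK] by (simp add: x_def less_eq_vec_def)
  moreover have "x \<le> 1"
    using \<epsilon>0 w1 by (auto simp: x_def less_eq_vec_def intro!: mult_nonneg_nonneg intro: order_trans[of 0 1])
  ultimately have "q \<le> x"
    using lfp_le_prefixpoint[OF wf lfp] by (simp add: eval_pps_def less_eq_vec_def)
  then have "\<epsilon> * w $ i \<le> 1 - q $ i" by (auto simp: less_eq_vec_def x_def algebra_simps)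
  moreover have "\<epsilon> * 1 \<le> \<epsilon> * w $ i" using \<epsilon>0 w1 by (intro mult_left_mono) auto
  moreover have "\<epsilon> = 1 / 2 ^ (4 * pps_size P)"
    by (simp add: \<epsilon>_def K_def flip: power_mult)
  ultimately show ?thesis by simp
qed

end

theorem theorem3p8:
  fixes P :: "('n::finite) snf_system" and \<kappa> :: pps_kind
    and q :: "real ^ 'n" and j h :: nat
  assumes "snf_pps P"
    and "is_lfp \<kappa> P q"
    and "\<forall>i. 0 < q $ i \<and> q $ i < 1"
    and "0 < j"
    and "h = j + 2 + 4 * pps_size P"
  shows "(\<forall>k. \<exists>!a. gnm_optimal \<kappa> P (rgnm \<kappa> P h k) a) \<and>
         (\<forall>k. 0 \<le> rgnm \<kappa> P h k \<and> rgnm \<kappa> P h k \<le> q) \<and>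
         infnorm (q - rgnm \<kappa> P h (j + 2 + 4 * pps_size P)) \<le> 1 / 2 ^ j"
proof -
  interpret snf_lfp_interior \<kappa> P q
    using assms by unfold_locales auto
  let ?B = "4 * pps_size P"
  have "\<bar>(q - rgnm \<kappa> P h h) $ i\<bar> \<le> 1 / 2 ^ j" for i
  proof -
    have "q $ i - rgnm \<kappa> P h h $ i \<le> (2 ^ ?B / 2 ^ h + 2 * 2 ^ ?B / 2 ^ h) * (1 - q $ i)"
      by (rule rgnm_error[OF one_minus_lfp_ge])
    \<comment> \<open>After \<open>h\<close> steps the iteration error and the accumulated rounding
      are a quarter and a half of \<open>1 / 2 ^ j\<close>; the 2 in \<open>h\<close> provides these
      fractions.\<close>
    also have "2 ^ ?B / 2 ^ h + 2 * 2 ^ ?B / 2 ^ h = 3 / 4 * (1 / 2 ^ j :: real)"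
      by (simp add: assms(5) power_add)
    also have "\<dots> * (1 - q $ i) \<le> 1 / 2 ^ j * 1"
      using q_pos[of i] q_less_one[of i] by (intro mult_mono) (auto simp: field_simps)
    finally have "q $ i - rgnm \<kappa> P h h $ i \<le> 1 / 2 ^ j" by simp
    then show ?thesis using rgnm_bounds[of h h] by (simp add: less_eq_vec_def)
  qed
  then have "infnorm (q - rgnm \<kappa> P h h) \<le> 1 / 2 ^ j"
    unfolding infnorm_cart by (intro cSup_least) auto
  then show ?thesis using gnm_optimal_ex1 rgnm_bounds assms(5) by auto
qed

end
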